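(* Let $(X(t))$ be an irreducible and transient Markov chain on a countable set $E$ with substochastic transition matrix $(p(x,y))_{x,y\in E}$, where $E$ is a subset of a group $(\mathcal E,\star)$. Let $u\in E$ be such that $E\star u\subset E$ and $p(x\star u,y\star u)=p(x,y)$ for all $x,y\in E$, and let $\eta_u=\inf\{t\ge1:X(t)\notin E\star u\}$. Then for any function $h:E\to[0,\infty)$, $$GA_uh(y)=\mathbb E_{y\star u}\bigl(h(X(\eta_u)),\ \eta_u<\tau_\vartheta\le+\infty\bigr),\qquad\forall y\in E.$$ If moreover the hitting probabilities of $(X(t))$ are slowly varying along $u$, i.e. uniformly in $x\in E$ $$\lim_{n\to\infty}\frac1n\log Q(x,x\star u^{\star n})=\lim_{n\to\infty}\frac1n\log Q(x\star u^{\star n},x)=0,$$ then for any $x\in E$ and any non-zero harmonic function $h$ of $(X(t))$, the quantity $h(x)/h(x\star u)$ is equal to the probability that the $h$-transform $(X_h(t))$ of $(X(t))$ starting at $x\star u$ never exits from the set $E\star u$.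
   Context: Irreducible: for all $x,y\in E$ there is $n\ge1$ with $\mathbb P_x(X(n)=y)>0$. The chain is completed by an absorbing state $\vartheta\notin E$ with $p(x,\vartheta)=1-\sum_{y\in E}p(x,y)$, and $\tau_\vartheta=\inf\{t\ge1:X(t)=\vartheta\}$. Green function: $G(x,y)=\sum_{t\ge0}\mathbb P_x(X(t)=y)$, $x,y\in E$; $G\varphi(x)=\sum_{y\in E}G(x,y)\varphi(y)$. $Q(x,y)=\mathbb P_x(X(t)=y\text{ for some }0<t<+\infty)$; $u^{\star1}=u$, $u^{\star(n+1)}=u^{\star n}\star u$. $A_u\varphi(x)=\sum_{y\in E}a_u(x,y)\varphi(y)$, where $a_u(x,y)=p(x\star u,y)-p(x,y\star u^{-1})$ if $y\in E\star u$ and $a_u(x,y)=p(x\star u,y)$ if $y\in E\setminus(E\star u)$. A harmonic function is a non-zero $h:E\to[0,\infty)$ with $\sum_{y\in E}p(x,y)h(y)=h(x)$ for all $x\in E$ (it is then strictly positive on $E$ by irreducibility). The $h$-transform $(X_h(t))$ is the Markov chain on $E$ with (stochastic) transition probabilities $p_h(x,y)=p(x,y)h(y)/h(x)$. *)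

theory Defs
  imports "HOL-Probability.Probability" "HOL-Algebra.Coset"
begin

text \<open>
  A Markov chain with countable state space \<open>S\<close> and transition probabilities \<open>q\<close> is given by
  a process \<open>X\<close> and a family \<open>P\<close> of laws indexed by the starting point.  The Markov property is
  written multiplicatively, so that no conditioning on null events occurs.
\<close>

definition markov_chain ::
  "'s set \<Rightarrow> ('s \<Rightarrow> 's \<Rightarrow> real) \<Rightarrow> ('s \<Rightarrow> 'w measure) \<Rightarrow> (nat \<Rightarrow> 'w \<Rightarrow> 's) \<Rightarrow> bool" where
  "markov_chain S q P X \<longleftrightarrow>
     (\<forall>x\<in>S. prob_space (P x)
        \<and> (\<forall>t. X t \<in> measurable (P x) (count_space S))
        \<and> \<P>(\<omega> in P x. X 0 \<omega> = x) = 1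
        \<and> (\<forall>n s. (\<forall>i\<le>Suc n. s i \<in> S) \<longrightarrow>
             \<P>(\<omega> in P x. \<forall>i\<le>Suc n. X i \<omega> = s i)
               = \<P>(\<omega> in P x. \<forall>i\<le>n. X i \<omega> = s i) * q (s n) (s (Suc n))))"

definition substochastic :: "'a set \<Rightarrow> ('a \<Rightarrow> 'a \<Rightarrow> real) \<Rightarrow> bool" where
  "substochastic E p \<longleftrightarrow>
     (\<forall>x\<in>E. (\<forall>y\<in>E. 0 \<le> p x y) \<and> p x summable_on E \<and> (\<Sum>\<^sub>\<infinity>y\<in>E. p x y) \<le> 1)"

text \<open>
  The completion of \<open>E\<close> by an absorbing state: \<open>Some x\<close> stands for \<open>x \<in> E\<close> and \<open>None\<close> for
  the cemetery \<open>\<vartheta>\<close>.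
\<close>

definition completed_space :: "'a set \<Rightarrow> 'a option set" where
  "completed_space E = insert None (Some ` E)"

fun completed_kernel ::
  "'a set \<Rightarrow> ('a \<Rightarrow> 'a \<Rightarrow> real) \<Rightarrow> 'a option \<Rightarrow> 'a option \<Rightarrow> real" where
  "completed_kernel E p (Some x) (Some y) = p x y"
| "completed_kernel E p (Some x) None = 1 - (\<Sum>\<^sub>\<infinity>y\<in>E. p x y)"
| "completed_kernel E p None (Some y) = 0"
| "completed_kernel E p None None = 1"

definition irreducible_chain ::
  "'a set \<Rightarrow> ('a option \<Rightarrow> 'w measure) \<Rightarrow> (nat \<Rightarrow> 'w \<Rightarrow> 'a option) \<Rightarrow> bool" where
  "irreducible_chain E P X \<longleftrightarrow>
     (\<forall>x\<in>E. \<forall>y\<in>E. \<exists>n\<ge>1. \<P>(\<omega> in P (Some x). X n \<omega> = Some y) > 0)"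

definition hitting_prob ::
  "('a option \<Rightarrow> 'w measure) \<Rightarrow> (nat \<Rightarrow> 'w \<Rightarrow> 'a option) \<Rightarrow> 'a \<Rightarrow> 'a \<Rightarrow> real" where
  "hitting_prob P X x y = \<P>(\<omega> in P (Some x). \<exists>t>0. X t \<omega> = Some y)"

definition transient_chain ::
  "'a set \<Rightarrow> ('a option \<Rightarrow> 'w measure) \<Rightarrow> (nat \<Rightarrow> 'w \<Rightarrow> 'a option) \<Rightarrow> bool" where
  "transient_chain E P X \<longleftrightarrow> (\<forall>x\<in>E. hitting_prob P X x x < 1)"

definition green ::
  "('a option \<Rightarrow> 'w measure) \<Rightarrow> (nat \<Rightarrow> 'w \<Rightarrow> 'a option) \<Rightarrow> 'a \<Rightarrow> 'a \<Rightarrow> ereal" where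
  "green P X x y = (\<Sum>t. ereal (\<P>(\<omega> in P (Some x). X t \<omega> = Some y)))"

text \<open>
  For unbounded functions the sums defining the operators below may be infinite,
  so they are taken in the extended reals.
\<close>

definition green_op ::
  "'a set \<Rightarrow> ('a option \<Rightarrow> 'w measure) \<Rightarrow> (nat \<Rightarrow> 'w \<Rightarrow> 'a option)
     \<Rightarrow> ('a \<Rightarrow> ereal) \<Rightarrow> 'a \<Rightarrow> ereal" where
  "green_op E P X \<phi> x = (\<Sum>\<^sub>\<infinity>y\<in>E. green P X x y * \<phi> y)"

definition a_kernel ::
  "('a, 'm) monoid_scheme \<Rightarrow> 'a set \<Rightarrow> ('a \<Rightarrow> 'a \<Rightarrow> real) \<Rightarrow> 'a \<Rightarrow> 'a \<Rightarrow> 'a \<Rightarrow> real" where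
  "a_kernel \<G> E p u x y =
     (if y \<in> E #>\<^bsub>\<G>\<^esub> u
      then p (x \<otimes>\<^bsub>\<G>\<^esub> u) y - p x (y \<otimes>\<^bsub>\<G>\<^esub> inv\<^bsub>\<G>\<^esub> u)
      else p (x \<otimes>\<^bsub>\<G>\<^esub> u) y)"

definition A_op ::
  "('a, 'm) monoid_scheme \<Rightarrow> 'a set \<Rightarrow> ('a \<Rightarrow> 'a \<Rightarrow> real) \<Rightarrow> 'a \<Rightarrow> ('a \<Rightarrow> real) \<Rightarrow> 'a \<Rightarrow> ereal" where
  "A_op \<G> E p u \<phi> x = (\<Sum>\<^sub>\<infinity>y\<in>E. ereal (a_kernel \<G> E p u x y * \<phi> y))"

text \<open>The first time \<open>t \<ge> 1\<close> at which a path is in \<open>B\<close>; the infimum of the empty set is \<open>\<infinity>\<close>.\<close>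

definition hit_time :: "'s set \<Rightarrow> (nat \<Rightarrow> 's) \<Rightarrow> enat" where
  "hit_time B w = Inf (enat ` {t. 1 \<le> t \<and> w t \<in> B})"

definition \<tau>_cemetery :: "(nat \<Rightarrow> 'w \<Rightarrow> 'a option) \<Rightarrow> 'w \<Rightarrow> enat" where
  "\<tau>_cemetery X \<omega> = hit_time {None} (\<lambda>t. X t \<omega>)"

text \<open>The cemetery lies outside \<open>E \<star> u\<close>, so being killed counts as an exit here.\<close>

definition \<eta>_exit ::
  "('a, 'm) monoid_scheme \<Rightarrow> 'a set \<Rightarrow> 'a \<Rightarrow> (nat \<Rightarrow> 'w \<Rightarrow> 'a option) \<Rightarrow> 'w \<Rightarrow> enat" where
  "\<eta>_exit \<G> E u X \<omega> = hit_time (- Some ` (E #>\<^bsub>\<G>\<^esub> u)) (\<lambda>t. X t \<omega>)"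

text \<open>
  The expectation of \<open>h (X(\<eta>))\<close> on the event \<open>\<eta> < \<tau>\<close>.  On that event \<open>\<eta>\<close> is finite and
  \<open>X(\<eta>)\<close> is not the cemetery, so the values of \<open>the_enat\<close> and \<open>the\<close> elsewhere are irrelevant.
\<close>

definition exit_expectation ::
  "('a, 'm) monoid_scheme \<Rightarrow> 'a set \<Rightarrow> 'a \<Rightarrow> ('a option \<Rightarrow> 'w measure)
     \<Rightarrow> (nat \<Rightarrow> 'w \<Rightarrow> 'a option) \<Rightarrow> ('a \<Rightarrow> real) \<Rightarrow> 'a \<Rightarrow> ennreal" where
  "exit_expectation \<G> E u P X h x =
     (\<integral>\<^sup>+ \<omega>. ennreal (h (the (X (the_enat (\<eta>_exit \<G> E u X \<omega>)) \<omega>)))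
            * indicator {\<omega>. \<eta>_exit \<G> E u X \<omega> < \<tau>_cemetery X \<omega>} \<omega> \<partial>P (Some x))"

definition slowly_varying_along ::
  "('a, 'm) monoid_scheme \<Rightarrow> 'a set \<Rightarrow> ('a option \<Rightarrow> 'w measure)
     \<Rightarrow> (nat \<Rightarrow> 'w \<Rightarrow> 'a option) \<Rightarrow> 'a \<Rightarrow> bool" where
  "slowly_varying_along \<G> E P X u \<longleftrightarrow>
     uniform_limit E
       (\<lambda>n x. 1 / real n * ln (hitting_prob P X x (x \<otimes>\<^bsub>\<G>\<^esub> (u [^]\<^bsub>\<G>\<^esub> n)))) (\<lambda>x. 0) sequentially
   \<and> uniform_limit E
       (\<lambda>n x. 1 / real n * ln (hitting_prob P X (x \<otimes>\<^bsub>\<G>\<^esub> (u [^]\<^bsub>\<G>\<^esub> n)) x)) (\<lambda>x. 0) sequentially"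

definition harmonic :: "'a set \<Rightarrow> ('a \<Rightarrow> 'a \<Rightarrow> real) \<Rightarrow> ('a \<Rightarrow> real) \<Rightarrow> bool" where
  "harmonic E p h \<longleftrightarrow>
     (\<forall>x\<in>E. 0 \<le> h x) \<and> (\<exists>x\<in>E. h x \<noteq> 0)
   \<and> (\<forall>x\<in>E. ((\<lambda>y. p x y * h y) has_sum h x) E)"

definition h_transform :: "('a \<Rightarrow> 'a \<Rightarrow> real) \<Rightarrow> ('a \<Rightarrow> real) \<Rightarrow> 'a \<Rightarrow> 'a \<Rightarrow> real" where
  "h_transform p h x y = p x y * h y / h x"

end

theory Submission imports Defs begin

text \<open>
  The translation invariance makes \<open>a_u\<close> vanish on \<open>E \<star> u\<close>, so \<open>G A_u h(y)\<close> sums over the last step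
  before the exit, and the first identity is the last-exit decomposition of the exit law.

  For the second part let \<open>T h = lim P^k h(\<cdot> \<star> u)\<close>, a decreasing limit, which is the largest harmonic
  minorant of \<open>h(\<cdot> \<star> u)\<close>. Then \<open>T h(x) / h(x \<star> u)\<close> is the probability that the \<open>h\<close>-transform started at
  \<open>x \<star> u\<close> stays in \<open>E \<star> u\<close>, and it remains to see that \<open>T h = h\<close>. Since \<open>Q(x, y) h(y) \<le> h(x)\<close>, slow
  variation gives \<open>e^(-\<epsilon>n) h \<le> h(\<cdot> \<star> u^n) \<le> e^(\<epsilon>n) h\<close> for large \<open>n\<close>, uniformly in all nonnegative
  harmonic \<open>h\<close>. As \<open>T^n h\<close> is the largest harmonic minorant of \<open>h(\<cdot> \<star> u^n)\<close>, the positive linear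
  operator \<open>T\<close> satisfies \<open>e^(-\<epsilon>n) \<le> T^n \<le> e^(\<epsilon>n)\<close> on the cone of harmonic functions, and a Neumann
  series argument takes \<open>n\<close>-th roots: \<open>e^(-\<epsilon>) \<le> T \<le> e^\<epsilon>\<close>. No integral representation of \<open>h\<close> by
  minimal harmonic functions is needed.
\<close>

section \<open>Sums over countable sets\<close>

text \<open>Countability provides finite sets \<open>B n\<close>, the elements of \<open>A\<close>
  with code below \<open>n\<close>, that exhaust \<open>A\<close>; monotone convergence along them
  gives the nontrivial inequality.\<close>

lemma nn_integral_count_space_eq_SUP:
  fixes f :: "'a \<Rightarrow> ennreal"
  assumes "countable A"
  shows "(\<integral>\<^sup>+x. f x \<partial>count_space A) = (SUP F\<in>{F. finite F \<and> F \<subseteq> A}. sum f F)"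
proof (rule antisym)
  define B where "B n = to_nat_on A -` {..<n} \<inter> A" for n
  have inj: "inj_on (to_nat_on A) A" using assms by (rule inj_on_to_nat_on)
  have fin: "finite (B n)" for n
    unfolding B_def by (rule finite_vimage_IntI[OF _ inj]) simp
  have sub: "B n \<subseteq> A" for n by (auto simp: B_def)
  have "(\<integral>\<^sup>+x. f x \<partial>count_space A) = (\<integral>\<^sup>+x. (SUP n. f x * indicator (B n) x) \<partial>count_space A)"
  proof (rule nn_integral_cong)
    fix x assume "x \<in> space (count_space A)"
    then have "x \<in> B (Suc (to_nat_on A x))" by (simp add: B_def)
    then have "f x \<le> (SUP n. f x * indicator (B n) x)"
      by (intro SUP_upper2[of "Suc (to_nat_on A x)"]) auto
    moreover have "(SUP n. f x * indicator (B n) x) \<le> f x"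
      by (intro SUP_least) (auto split: split_indicator)
    ultimately show "f x = (SUP n. f x * indicator (B n) x)" by (rule antisym)
  qed
  also have "\<dots> = (SUP n. \<integral>\<^sup>+x. f x * indicator (B n) x \<partial>count_space A)"
    by (rule nn_integral_monotone_convergence_SUP)
       (auto simp: incseq_def le_fun_def B_def split: split_indicator)
  also have "\<dots> = (SUP n. sum f (B n))"
  proof (rule SUP_cong)
    fix n
    have "(\<integral>\<^sup>+x. f x * indicator (B n) x \<partial>count_space A) = (\<Sum>x\<in>B n. f x * indicator (B n) x)"
      using fin sub by (intro nn_integral_count_space') (auto simp: indicator_def)
    then show "(\<integral>\<^sup>+x. f x * indicator (B n) x \<partial>count_space A) = sum f (B n)" by simp
  qed simp
  also have "\<dots> \<le> (SUP F\<in>{F. finite F \<and> F \<subseteq> A}. sum f F)"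
    using fin sub by (intro SUP_mono) auto
  finally show "(\<integral>\<^sup>+x. f x \<partial>count_space A) \<le> (SUP F\<in>{F. finite F \<and> F \<subseteq> A}. sum f F)" .
  show "(SUP F\<in>{F. finite F \<and> F \<subseteq> A}. sum f F) \<le> (\<integral>\<^sup>+x. f x \<partial>count_space A)"
  proof (rule SUP_least)
    fix F assume F: "F \<in> {F. finite F \<and> F \<subseteq> A}"
    then have "sum f F = (\<Sum>x\<in>F. f x * indicator F x)" by simp
    also have "\<dots> = (\<integral>\<^sup>+x. f x * indicator F x \<partial>count_space A)"
      using F by (intro nn_integral_count_space'[symmetric]) (auto simp: indicator_def)
    also have "\<dots> \<le> (\<integral>\<^sup>+x. f x \<partial>count_space A)"
      by (intro nn_integral_mono) (auto split: split_indicator)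
    finally show "sum f F \<le> (\<integral>\<^sup>+x. f x \<partial>count_space A)" .
  qed
qed

text \<open>Both sides are suprema of the same finite partial sums. This links the
  \<open>ereal\<close> sums in \<open>green_op\<close> and \<open>A_op\<close> to integrals, where
  Tonelli is available.\<close>

lemma infsum_ereal_eq_nn_integral:
  assumes "countable A"
  shows "(\<Sum>\<^sub>\<infinity>x\<in>A. enn2ereal (f x)) = enn2ereal (\<integral>\<^sup>+x. f x \<partial>count_space A)"
proof -
  have ne: "{F. finite F \<and> F \<subseteq> A} \<noteq> {}" by auto
  have sum: "enn2ereal (sum f F) = (\<Sum>x\<in>F. enn2ereal (f x))" for F
    by (induction F rule: infinite_finite_induct) (auto simp: zero_ennreal.rep_eq plus_ennreal.rep_eq)
  have "(\<Sum>\<^sub>\<infinity>x\<in>A. enn2ereal (f x)) = (SUP F\<in>{F. finite F \<and> F \<subseteq> A}. \<Sum>x\<in>F. enn2ereal (f x))"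
    by (rule nonneg_infsum_complete) simp
  also have "\<dots> = enn2ereal (SUP F\<in>{F. finite F \<and> F \<subseteq> A}. sum f F)"
    unfolding sum[symmetric] using ne
    by (simp add: Sup_ennreal.rep_eq image_image sup_absorb2 SUP_upper2[of "{}"] )
  finally show ?thesis by (simp add: nn_integral_count_space_eq_SUP[OF assms])
qed

text \<open>Serves to turn the real-valued harmonic equation into an identity for
  \<open>trans_op\<close>.\<close>

lemma has_sum_imp_nn_integral:
  fixes f :: "'a \<Rightarrow> real"
  assumes "countable A" "\<And>x. x \<in> A \<Longrightarrow> 0 \<le> f x" "(f has_sum s) A"
  shows "(\<integral>\<^sup>+x. ennreal (f x) \<partial>count_space A) = ennreal s"
proof -
  have s: "s = infsum f A" "f summable_on A"
    using assms(3) by (auto simp: infsumI summable_on_def)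
  have "(\<Sum>x\<in>F. ennreal (f x)) = ennreal (sum f F)" if "F \<subseteq> A" for F
    using assms(2) that by (intro sum_ennreal) auto
  then have "(SUP F\<in>{F. finite F \<and> F \<subseteq> A}. \<Sum>x\<in>F. ennreal (f x)) =
      (SUP F\<in>{F. finite F \<and> F \<subseteq> A}. ennreal (sum f F))"
    by (intro SUP_cong) auto
  then show ?thesis
    using infsum_nonneg_is_SUPREMUM_ennreal[OF s(2) assms(2)]
    by (simp add: nn_integral_count_space_eq_SUP[OF assms(1)] s(1))
qed

section \<open>Positive operators on a cone of functions\<close>

text \<open>\<open>cone_diff\<close> makes the pointwise order on \<open>K\<close> the order induced
  by the cone, which is what turns additivity of an operator into monotonicity.\<close>

locale function_cone =
  fixes K :: "('a \<Rightarrow> real) set"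
  assumes cone_nonneg: "f \<in> K \<Longrightarrow> 0 \<le> f x"
    and cone_comb: "\<lbrakk>f \<in> K; g \<in> K; 0 \<le> a; 0 \<le> b\<rbrakk> \<Longrightarrow> (\<lambda>x. a * f x + b * g x) \<in> K"
    and cone_diff: "\<lbrakk>f \<in> K; g \<in> K; \<And>x. f x \<le> g x\<rbrakk> \<Longrightarrow> (\<lambda>x. g x - f x) \<in> K"
begin

definition cone_operator :: "(('a \<Rightarrow> real) \<Rightarrow> 'a \<Rightarrow> real) \<Rightarrow> bool" where
  "cone_operator T \<longleftrightarrow> (\<forall>f\<in>K. T f \<in> K) \<and>
     (\<forall>f\<in>K. \<forall>g\<in>K. \<forall>a\<ge>0. \<forall>b\<ge>0. T (\<lambda>x. a * f x + b * g x) = (\<lambda>x. a * T f x + b * T g x))"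

lemma cone_scale: "f \<in> K \<Longrightarrow> 0 \<le> a \<Longrightarrow> (\<lambda>x. a * f x) \<in> K"
  using cone_comb[of f f a 0] by simp

lemma cone_operator_in: "cone_operator T \<Longrightarrow> f \<in> K \<Longrightarrow> T f \<in> K"
  by (simp add: cone_operator_def)

lemma cone_operator_comb:
  "\<lbrakk>cone_operator T; f \<in> K; g \<in> K; 0 \<le> a; 0 \<le> b\<rbrakk>
    \<Longrightarrow> T (\<lambda>x. a * f x + b * g x) = (\<lambda>x. a * T f x + b * T g x)"
  by (simp add: cone_operator_def)

lemma cone_operator_scale:
  "cone_operator T \<Longrightarrow> f \<in> K \<Longrightarrow> 0 \<le> a \<Longrightarrow> T (\<lambda>x. a * f x) = (\<lambda>x. a * T f x)"
  using cone_operator_comb[of T f f a 0] by simp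

text \<open>Additivity is applied to \<open>g = f + (g - f)\<close>, whose second summand lies in
  \<open>K\<close> and so has a nonnegative image.\<close>

lemma cone_operator_mono:
  assumes T: "cone_operator T" and fg: "f \<in> K" "g \<in> K" "\<And>x. f x \<le> g x"
  shows "T f x \<le> T g x"
proof -
  have d: "(\<lambda>x. g x - f x) \<in> K" using fg by (rule cone_diff)
  have "T g = T (\<lambda>x. 1 * f x + 1 * (g x - f x))" by simp
  also have "\<dots> = (\<lambda>x. 1 * T f x + 1 * T (\<lambda>x. g x - f x) x)"
    using T fg(1) d by (rule cone_operator_comb) auto
  finally show ?thesis
    using cone_nonneg[OF cone_operator_in[OF T d], of x] by simp
qed

lemma cone_operator_funpow: "cone_operator T \<Longrightarrow> cone_operator (T ^^ n)"
proof (induction n)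
  case 0
  then show ?case by (simp add: cone_operator_def)
next
  case (Suc n)
  then show ?case by (simp add: cone_operator_def)
qed

lemma cone_operator_add:
  assumes S: "cone_operator S" and T: "cone_operator T" and c: "0 \<le> c"
  shows "cone_operator (\<lambda>f x. c * S f x + T f x)"
  unfolding cone_operator_def
proof (intro conjI ballI allI impI)
  fix f assume "f \<in> K"
  then show "(\<lambda>x. c * S f x + T f x) \<in> K"
    using cone_comb[of "S f" "T f" c 1] S T c by (simp add: cone_operator_in)
next
  fix f g and a b :: real assume "f \<in> K" "g \<in> K" "0 \<le> a" "0 \<le> b"
  then show "(\<lambda>x. c * S (\<lambda>x. a * f x + b * g x) x + T (\<lambda>x. a * f x + b * g x) x) =
     (\<lambda>x. a * (c * S f x + T f x) + b * (c * S g x + T g x))"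
    by (simp add: cone_operator_comb S T algebra_simps)
qed

lemma cone_operator_diff:
  assumes S: "cone_operator S" and c: "0 \<le> c"
    and le: "\<And>f x. f \<in> K \<Longrightarrow> S f x \<le> c * f x"
  shows "cone_operator (\<lambda>f x. c * f x - S f x)"
  unfolding cone_operator_def
proof (intro conjI ballI allI impI)
  fix f assume f: "f \<in> K"
  show "(\<lambda>x. c * f x - S f x) \<in> K"
    by (rule cone_diff) (auto intro: cone_operator_in S f cone_scale c le)
next
  fix f g and a b :: real assume "f \<in> K" "g \<in> K" "0 \<le> a" "0 \<le> b"
  then show "(\<lambda>x. c * (a * f x + b * g x) - S (\<lambda>x. a * f x + b * g x) x) =
     (\<lambda>x. a * (c * f x - S f x) + b * (c * g x - S g x))"
    by (simp add: cone_operator_comb S algebra_simps)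
qed

section \<open>Inverses and roots of positive operators\<close>

text \<open>
  With \<open>R = C - S\<close>, which is again positive, the inverse of \<open>S\<close> is given by the Neumann series
  \<open>\<Sum>j. R^j / C^(j+1)\<close> of positive operators.
\<close>

lemma cone_operator_inverse_positive:
  assumes S: "cone_operator S" and c: "0 < c"
    and lower: "\<And>f x. f \<in> K \<Longrightarrow> c * f x \<le> S f x"
    and upper: "\<And>f x. f \<in> K \<Longrightarrow> S f x \<le> C * f x"
    and ab: "a \<in> K" "b \<in> K" and le: "\<And>x. S a x \<le> S b x"
  shows "a x \<le> b x"
proof (cases "c \<le> C")
  case False
  \<comment> \<open>Here \<open>C < c\<close>, and the two bounds on \<open>S\<close> squeeze
    \<open>a x\<close> to zero.\<close>
  have "c * a x \<le> C * a x" using lower[OF ab(1), of x] upper[OF ab(1), of x] by linarith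
  with False cone_nonneg[OF ab(1), of x] have "a x = 0"
    by (metis less_eq_real_def mult_less_cancel_right_disj not_le)
  then show ?thesis using cone_nonneg[OF ab(2), of x] by simp
next
  case True
  then have C: "0 < C" using c by simp
  define R where "R f x = C * f x - S f x" for f x
  have R: "cone_operator R"
    using cone_operator_diff[OF S less_imp_le[OF C] upper] unfolding R_def[abs_def] by simp
  have Rj: "cone_operator (R ^^ j)" for j by (rule cone_operator_funpow[OF R])
  \<comment> \<open>\<open>S a \<le> S b\<close> is rewritten as
    \<open>C a + R b \<le> C b + R a\<close>. Both sides belong to the cone, so the monotone
    operator \<open>R^j\<close> may be applied.\<close>
  have step: "C * (R ^^ j) a x + (R ^^ Suc j) b x \<le> C * (R ^^ j) b x + (R ^^ Suc j) a x" for j x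
  proof -
    have "(R ^^ j) (\<lambda>x. C * a x + 1 * R b x) x \<le> (R ^^ j) (\<lambda>x. C * b x + 1 * R a x) x"
    proof (rule cone_operator_mono[OF Rj])
      show "(\<lambda>x. C * a x + 1 * R b x) \<in> K" "(\<lambda>x. C * b x + 1 * R a x) \<in> K"
        using C by (intro cone_comb ab cone_operator_in[OF R]; simp)+
      show "C * a x + 1 * R b x \<le> C * b x + 1 * R a x" for x
        using le[of x] by (simp add: R_def)
    qed
    then show ?thesis
      using C by (simp add: cone_operator_comb[OF Rj ab(1) cone_operator_in[OF R ab(2)]]
          cone_operator_comb[OF Rj ab(2) cone_operator_in[OF R ab(1)]] cone_operator_comb[OF Rj, of _ _ C 1, simplified]
          ab cone_operator_in[OF R] funpow_swap1)
  qed
  \<comment> \<open>By \<open>step\<close>, each further power of \<open>R\<close> multiplies the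
    difference by at least \<open>C\<close>.\<close>
  have pow: "C ^ m * (a x - b x) \<le> (R ^^ m) a x - (R ^^ m) b x" for m
  proof (induction m)
    case (Suc m)
    have "C ^ Suc m * (a x - b x) \<le> C * ((R ^^ m) a x - (R ^^ m) b x)"
      using mult_left_mono[OF Suc, of C] C by (simp add: mult.assoc)
    also have "\<dots> \<le> (R ^^ Suc m) a x - (R ^^ Suc m) b x"
      using step[of m x] by (simp add: algebra_simps)
    finally show ?case .
  qed simp
  \<comment> \<open>The lower bound on \<open>S\<close> says \<open>R \<le> C - c\<close> on the
    cone, so \<open>R^m a\<close> grows at a rate below \<open>C\<close>.\<close>
  have decay: "(R ^^ m) a x \<le> (C - c) ^ m * a x" for m
  proof (induction m)
    case (Suc m)
    have "(R ^^ Suc m) a x \<le> (C - c) * (R ^^ m) a x"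
      using lower[OF cone_operator_in[OF Rj ab(1)], of m x] by (simp add: R_def algebra_simps)
    also have "\<dots> \<le> (C - c) ^ Suc m * a x"
      using mult_left_mono[OF Suc, of "C - c"] True by (simp add: mult.assoc)
    finally show ?case .
  qed simp
  \<comment> \<open>Dividing by \<open>C^m\<close> and dropping the nonnegative \<open>R^m b\<close>
    leaves a geometric bound with ratio \<open>1 - c / C\<close> in \<open>[0, 1)\<close>.\<close>
  have "a x - b x \<le> (1 - c / C) ^ m * a x" for m
  proof -
    have "C ^ m * (a x - b x) \<le> (C - c) ^ m * a x"
      using pow[of m] decay[of m] cone_nonneg[OF cone_operator_in[OF Rj ab(2)], of m x] by linarith
    then have "a x - b x \<le> ((C - c) ^ m * a x) / C ^ m"
      using C by (simp add: pos_le_divide_eq mult.commute)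
    also have "\<dots> = (1 - c / C) ^ m * a x"
    proof -
      have "1 - c / C = (C - c) / C" using C by (simp add: diff_divide_distrib)
      then show ?thesis by (simp add: power_divide)
    qed
    finally show ?thesis .
  qed
  moreover have "(\<lambda>m. (1 - c / C) ^ m * a x) \<longlonglongrightarrow> 0 * a x"
    using c C True by (intro tendsto_mult LIMSEQ_realpow_zero) auto
  ultimately have "a x - b x \<le> 0"
    by (intro LIMSEQ_le_const[of "\<lambda>m. (1 - c / C) ^ m * a x"]) auto
  then show ?thesis by simp
qed

text \<open>
  Both directions divide \<open>T^n - r^n\<close> by \<open>S = T^(n-1) + r T^(n-2) + \<dots> + r^(n-1)\<close>,
  whose inverse is positive.
\<close>

lemma cone_operator_power_bounds:
  assumes T: "cone_operator T" and bound: "\<And>f x. f \<in> K \<Longrightarrow> T f x \<le> B * f x"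
    and B: "0 \<le> B" and r: "0 < r" and n: "0 < n"
  shows "(\<And>f x. f \<in> K \<Longrightarrow> r ^ n * f x \<le> (T ^^ n) f x) \<Longrightarrow> f \<in> K \<Longrightarrow> r * f x \<le> T f x"
    and "(\<And>f x. f \<in> K \<Longrightarrow> (T ^^ n) f x \<le> r ^ n * f x) \<Longrightarrow> f \<in> K \<Longrightarrow> T f x \<le> r * f x"
proof -
  \<comment> \<open>\<open>S m\<close> is the sum of \<open>r^(m-1-i) T^i\<close> over
    \<open>i < m\<close>, in recursive form.\<close>
  define S where "S = rec_nat (\<lambda>f x. 0) (\<lambda>m Sm f x. r * Sm f x + (T ^^ m) f x)"
  have S0: "S 0 = (\<lambda>f x. 0)" and SSuc: "S (Suc m) = (\<lambda>f x. r * S m f x + (T ^^ m) f x)" for m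
    by (simp_all add: S_def)
  have Tm: "cone_operator (T ^^ m)" for m by (rule cone_operator_funpow[OF T])
  have zero: "(\<lambda>x. 0) \<in> K" if "f \<in> K" for f using cone_scale[OF that, of 0] by simp
  have S: "cone_operator (S m)" for m
  proof (induction m)
    case 0
    then show ?case by (auto simp: S0 cone_operator_def zero)
  next
    case (Suc m)
    then show ?case unfolding SSuc using Tm r by (intro cone_operator_add) auto
  qed
  \<comment> \<open>The factorisation \<open>S m (T - r) = T^m - r^m\<close>, arranged without
    subtraction.\<close>
  have telescope: "S m (T f) x + r ^ m * f x = r * S m f x + (T ^^ m) f x" for m f x
  proof (induction m)
    case (Suc m)
    have "S (Suc m) (T f) x + r ^ Suc m * f x = r * (S m (T f) x + r ^ m * f x) + (T ^^ Suc m) f x"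
      by (simp add: SSuc algebra_simps funpow_swap1)
    also have "\<dots> = r * S (Suc m) f x + (T ^^ Suc m) f x" by (simp add: Suc SSuc)
    finally show ?case .
  qed (simp add: S0)
  have Tm_bound: "(T ^^ m) f x \<le> B ^ m * f x" if "f \<in> K" for m f x
  proof (induction m)
    case (Suc m)
    have "(T ^^ Suc m) f x \<le> B * (T ^^ m) f x"
      using bound[OF cone_operator_in[OF Tm that]] by simp
    also have "\<dots> \<le> B ^ Suc m * f x" using mult_left_mono[OF Suc B] by (simp add: mult.assoc)
    finally show ?case .
  qed simp
  \<comment> \<open>Inverting \<open>S n\<close> requires some upper constant; it is accumulated
    from the powers of \<open>B\<close>.\<close>
  have "\<exists>C. \<forall>f\<in>K. \<forall>x. S m f x \<le> C * f x" for m
  proof (induction m)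
    case 0
    show ?case by (rule exI[of _ 0]) (simp add: S0)
  next
    case (Suc m)
    then obtain C where C: "\<And>f x. f \<in> K \<Longrightarrow> S m f x \<le> C * f x" by blast
    have "S (Suc m) f x \<le> (r * C + B ^ m) * f x" if "f \<in> K" for f x
    proof -
      have "r * S m f x \<le> r * (C * f x)" using C[OF that] r by (intro mult_left_mono) auto
      then show ?thesis
        using Tm_bound[OF that, of m x] by (simp add: SSuc ring_distribs mult.assoc)
    qed
    then show ?case by blast
  qed
  then obtain C where upper: "\<And>f x. f \<in> K \<Longrightarrow> S n f x \<le> C * f x" by blast
  obtain k where k: "n = Suc k" using n by (cases n) auto
  \<comment> \<open>Only the summand with \<open>i = 0\<close> is kept. For \<open>n = Suc k\<close>
    it supplies the positive lower constant \<open>r^k\<close> for inverting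
    \<open>S n\<close>.\<close>
  have lower: "r ^ m * f x \<le> S (Suc m) f x" if "f \<in> K" for m f x
  proof (induction m)
    case 0
    show ?case by (simp add: S0 SSuc)
  next
    case (Suc m)
    have "r ^ Suc m * f x \<le> r * S (Suc m) f x"
      using mult_left_mono[OF Suc, of r] r by (simp add: mult.assoc)
    also have "\<dots> \<le> S (Suc (Suc m)) f x"
      unfolding SSuc[of "Suc m"] using cone_nonneg[OF cone_operator_in[OF Tm that], of "Suc m" x] by simp
    finally show ?case .
  qed
  have inv: "a x \<le> b x" if "a \<in> K" "b \<in> K" "\<And>x. S n a x \<le> S n b x" for a b x
    by (rule cone_operator_inverse_positive[OF S[of n] _ lower[of _ k, folded k] upper that])
       (use r in auto)
  have scale: "(\<lambda>x. r * f x) \<in> K" "S n (\<lambda>x. r * f x) = (\<lambda>x. r * S n f x)" if "f \<in> K" for f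
    using that r by (auto intro: cone_scale simp: cone_operator_scale[OF S])
  \<comment> \<open>By \<open>telescope\<close>, comparing \<open>r^n f\<close> with
    \<open>T^n f\<close> amounts to comparing \<open>S n (r f)\<close> with
    \<open>S n (T f)\<close>, and \<open>inv\<close> then cancels \<open>S n\<close>. The other
    direction is symmetric.\<close>
  show "r * f x \<le> T f x" if h: "\<And>f x. f \<in> K \<Longrightarrow> r ^ n * f x \<le> (T ^^ n) f x" and f: "f \<in> K" for f x
  proof (rule inv[OF scale(1)[OF f] cone_operator_in[OF T f]])
    show "S n (\<lambda>x. r * f x) x \<le> S n (T f) x" for x
      using telescope[of n f x] h[OF f, of x] by (simp add: scale(2)[OF f])
  qed
  show "T f x \<le> r * f x" if h: "\<And>f x. f \<in> K \<Longrightarrow> (T ^^ n) f x \<le> r ^ n * f x" and f: "f \<in> K" for f x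
  proof (rule inv[OF cone_operator_in[OF T f] scale(1)[OF f]])
    show "S n (T f) x \<le> S n (\<lambda>x. r * f x) x" for x
      using telescope[of n f x] h[OF f, of x] by (simp add: scale(2)[OF f])
  qed
qed

text \<open>For each \<epsilon> the root of one large power gives
  \<open>exp (- \<epsilon>) f \<le> T f \<le> exp \<epsilon> f\<close>; then \<epsilon> tends to 0
  at a fixed point.\<close>

lemma cone_operator_eq_id:
  assumes T: "cone_operator T"
    and subexp: "\<And>\<epsilon>. 0 < \<epsilon> \<Longrightarrow> \<exists>N. \<forall>n\<ge>N. \<forall>f\<in>K. \<forall>x.
        exp (- \<epsilon> * n) * f x \<le> (T ^^ n) f x \<and> (T ^^ n) f x \<le> exp (\<epsilon> * n) * f x"
    and f: "f \<in> K"
  shows "T f = f"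
proof
  fix x
  obtain N where N: "\<And>n g x. n \<ge> N \<Longrightarrow> g \<in> K \<Longrightarrow>
        exp (- real n) * g x \<le> (T ^^ n) g x \<and> (T ^^ n) g x \<le> exp (real n) * g x"
    using subexp[of 1] by auto
  \<comment> \<open>Root extraction asks for an a priori bound on \<open>T\<close>. It comes from
    \<epsilon> = 1, by playing the lower bound for \<open>T^N\<close> at \<open>T g\<close> against
    the upper bound for \<open>T^(N+1)\<close> at \<open>g\<close>.\<close>
  have bound: "T g y \<le> exp (real N + real (Suc N)) * g y" if g: "g \<in> K" for g y
  proof -
    have "exp (- real N) * T g y \<le> (T ^^ Suc N) g y"
      using N[of N "T g" y] cone_operator_in[OF T g] by (simp add: funpow_swap1)
    also have "\<dots> \<le> exp (real (Suc N)) * g y"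
      using N[of "Suc N" g y] g by linarith
    finally have "exp (real N) * (exp (- real N) * T g y) \<le> exp (real N) * (exp (real (Suc N)) * g y)"
      by (intro mult_left_mono) auto
    then show ?thesis
      by (simp add: mult.assoc[symmetric] exp_add[symmetric] del: of_nat_Suc)
  qed
  have eps: "exp (- \<epsilon>) * f x \<le> T f x \<and> T f x \<le> exp \<epsilon> * f x" if \<epsilon>: "0 < \<epsilon>" for \<epsilon>
  proof -
    obtain N' where N': "\<And>n g x. n \<ge> N' \<Longrightarrow> g \<in> K \<Longrightarrow>
        exp (- \<epsilon> * n) * g x \<le> (T ^^ n) g x \<and> (T ^^ n) g x \<le> exp (\<epsilon> * n) * g x"
      using subexp[OF \<epsilon>] by blast
    have e: "exp (c * real n) = exp c ^ n" for c :: real and n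
      by (subst mult.commute) (rule exp_of_nat_mult)
    \<comment> \<open>The exponent \<open>Suc N'\<close> is positive, as root extraction
      requires.\<close>
    have "exp (- \<epsilon>) ^ Suc N' * g y \<le> (T ^^ Suc N') g y \<and> (T ^^ Suc N') g y \<le> exp \<epsilon> ^ Suc N' * g y"
      if "g \<in> K" for g y
      using N'[of "Suc N'" g y] that unfolding e by simp
    note * = this
    show ?thesis
      by (intro conjI cone_operator_power_bounds[OF T bound _ _ _ _ f, where n="Suc N'"])
         (use * in auto)
  qed
  have lim: "((\<lambda>\<epsilon>. exp (- \<epsilon>) * f x) \<longlongrightarrow> exp (- 0) * f x) (at_right 0)"
     "((\<lambda>\<epsilon>. exp \<epsilon> * f x) \<longlongrightarrow> exp 0 * f x) (at_right 0)"
    by (intro tendsto_intros)+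
  have ev: "eventually (\<lambda>\<epsilon>. exp (- \<epsilon>) * f x \<le> T f x \<and> T f x \<le> exp \<epsilon> * f x) (at_right (0::real))"
    using eps by (auto simp: eventually_at_right_field intro!: exI[of _ 1])
  have "f x \<le> T f x"
    using tendsto_upperbound[OF lim(1)] ev by (simp add: eventually_conj_iff)
  moreover have "T f x \<le> f x"
    using tendsto_lowerbound[OF lim(2)] ev by (simp add: eventually_conj_iff)
  ultimately show "T f x = f x" by simp
qed

end

section \<open>Taboo probabilities of a Markov chain\<close>

text \<open>Only times strictly between 0 and \<open>n\<close> are constrained. One notion thus
  covers transition probabilities (\<open>B = UNIV\<close>), first passages (\<open>B\<close> the
  complement of the target) and exits from \<open>B\<close> (\<open>z\<close> outside
  \<open>B\<close>).\<close>

definition taboo_prob ::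
  "('s \<Rightarrow> 'w measure) \<Rightarrow> (nat \<Rightarrow> 'w \<Rightarrow> 's) \<Rightarrow> 's set \<Rightarrow> 's \<Rightarrow> nat \<Rightarrow> 's \<Rightarrow> ennreal" where
  "taboo_prob P X B x n z =
     emeasure (P x) {\<omega> \<in> space (P x). (\<forall>i. 0 < i \<and> i < n \<longrightarrow> X i \<omega> \<in> B) \<and> X n \<omega> = z}"

text \<open>The \<open>n\<close>-step transition probabilities inside \<open>E\<close>, in
  \<open>ennreal\<close> so that all sums make sense. The last step is split off, in agreement with
  \<open>taboo_prob_Suc\<close>.\<close>

primrec step_kernel :: "'a set \<Rightarrow> ('a \<Rightarrow> 'a \<Rightarrow> real) \<Rightarrow> nat \<Rightarrow> 'a \<Rightarrow> 'a \<Rightarrow> ennreal" where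
  "step_kernel E p 0 x z = indicator {x} z"
| "step_kernel E p (Suc n) x z = (\<integral>\<^sup>+w. step_kernel E p n x w * ennreal (p w z) \<partial>count_space E)"

definition trans_op :: "'a set \<Rightarrow> ('a \<Rightarrow> 'a \<Rightarrow> real) \<Rightarrow> ('a \<Rightarrow> ennreal) \<Rightarrow> 'a \<Rightarrow> ennreal" where
  "trans_op E p F x = (\<integral>\<^sup>+y. ennreal (p x y) * F y \<partial>count_space E)"

text \<open>The kernel recursion splits off the last step, so the induction peels the innermost
  \<open>trans_op\<close> with \<open>F\<close> arbitrary, and Tonelli exchanges the two
  sums.\<close>

lemma trans_op_funpow:
  assumes "countable E" "x \<in> E"
  shows "(trans_op E p ^^ n) F x = (\<integral>\<^sup>+z. step_kernel E p n x z * F z \<partial>count_space E)"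
proof (induction n arbitrary: F)
  case 0
  have "(\<integral>\<^sup>+z. step_kernel E p 0 x z * F z \<partial>count_space E) = (\<Sum>z\<in>{x}. step_kernel E p 0 x z * F z)"
    using assms(2) by (intro nn_integral_count_space') auto
  then show ?case by simp
next
  case (Suc n)
  have "(trans_op E p ^^ Suc n) F x = (trans_op E p ^^ n) (trans_op E p F) x"
    by (simp only: funpow_Suc_right o_apply)
  also have "\<dots> = (\<integral>\<^sup>+w. \<integral>\<^sup>+z. step_kernel E p n x w * (p w z * F z) \<partial>count_space E \<partial>count_space E)"
    by (simp add: Suc trans_op_def nn_integral_cmult)
  also have "\<dots> = (\<integral>\<^sup>+z. \<integral>\<^sup>+w. step_kernel E p n x w * (p w z * F z) \<partial>count_space E \<partial>count_space E)"
    using assms(1) by (intro nn_integral_count_space_nn_integral) auto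
  also have "\<dots> = (\<integral>\<^sup>+z. step_kernel E p (Suc n) x z * F z \<partial>count_space E)"
    by (simp add: nn_integral_multc[symmetric] mult.assoc)
  finally show ?case .
qed

section \<open>Markov property for constrained histories, and taboo recursions\<close>

locale countable_chain =
  fixes S :: "'s set" and q :: "'s \<Rightarrow> 's \<Rightarrow> real" and P :: "'s \<Rightarrow> 'w measure" and X :: "nat \<Rightarrow> 'w \<Rightarrow> 's"
  assumes countable_S: "countable S" and chain: "markov_chain S q P X"
begin

lemma prob_space_P: "x \<in> S \<Longrightarrow> prob_space (P x)"
  using chain by (simp add: markov_chain_def)

lemma X_in_S: "x \<in> S \<Longrightarrow> \<omega> \<in> space (P x) \<Longrightarrow> X t \<omega> \<in> S"
  using chain measurable_space[of "X t" "P x" "count_space S" \<omega>] by (auto simp: markov_chain_def)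

lemma pred_X: "x \<in> S \<Longrightarrow> Measurable.pred (P x) (\<lambda>\<omega>. X t \<omega> \<in> A)"
proof -
  assume x: "x \<in> S"
  then have "X t \<in> measurable (P x) (count_space S)" using chain by (auto simp: markov_chain_def)
  then have "X t -` (A \<inter> S) \<inter> space (P x) \<in> sets (P x)" by (rule measurable_sets) simp
  also have "X t -` (A \<inter> S) \<inter> space (P x) = {\<omega> \<in> space (P x). X t \<omega> \<in> A}"
    using X_in_S[OF x] by auto
  finally show ?thesis by (simp add: pred_def)
qed

lemma pred_X_eq: "x \<in> S \<Longrightarrow> Measurable.pred (P x) (\<lambda>\<omega>. X t \<omega> = a)"
  using pred_X[of x t "{a}"] by simp

lemma path_probability:
  assumes x: "x \<in> S" and s: "\<And>i. i \<le> Suc n \<Longrightarrow> s i \<in> S"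
  shows "emeasure (P x) {\<omega> \<in> space (P x). \<forall>i\<le>Suc n. X i \<omega> = s i} =
    emeasure (P x) {\<omega> \<in> space (P x). \<forall>i\<le>n. X i \<omega> = s i} * ennreal (q (s n) (s (Suc n)))"
proof -
  interpret prob_space "P x" by (rule prob_space_P[OF x])
  have "\<P>(\<omega> in P x. \<forall>i\<le>Suc n. X i \<omega> = s i)
               = \<P>(\<omega> in P x. \<forall>i\<le>n. X i \<omega> = s i) * q (s n) (s (Suc n))"
    using chain x s by (auto simp: markov_chain_def)
  then show ?thesis by (simp add: emeasure_eq_measure ennreal_mult')
qed

text \<open>\<open>markov_chain\<close> speaks of completely specified paths. A constrained history
  is a disjoint union over the countable set \<open>L\<close> of admissible ones, and the common
  factor \<open>q w z\<close> comes out of the sum.\<close>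

lemma markov_step:
  assumes x: "x \<in> S" and w: "w \<in> S" and z: "z \<in> S"
  shows "emeasure (P x) {\<omega> \<in> space (P x). (\<forall>i<n. X i \<omega> \<in> D i) \<and> X n \<omega> = w \<and> X (Suc n) \<omega> = z} =
    emeasure (P x) {\<omega> \<in> space (P x). (\<forall>i<n. X i \<omega> \<in> D i) \<and> X n \<omega> = w} * ennreal (q w z)"
proof -
  define L where "L = {l \<in> lists S. length l = n \<and> (\<forall>i<n. l ! i \<in> D i)}"
  have L: "countable L"
    unfolding L_def by (rule countable_subset[OF _ countable_lists[OF countable_S]]) auto
  note [measurable] = pred_X_eq[OF x]
  define ev where "ev l = {\<omega> \<in> space (P x). (\<forall>i<n. X i \<omega> = l ! i) \<and> X n \<omega> = w}" for l
  define ev' where "ev' l = {\<omega> \<in> space (P x). (\<forall>i<n. X i \<omega> = l ! i) \<and> X n \<omega> = w \<and> X (Suc n) \<omega> = z}" for l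
  have ex: "map (\<lambda>i. X i \<omega>) [0..<n] \<in> L \<and> (\<forall>i<n. X i \<omega> = map (\<lambda>i. X i \<omega>) [0..<n] ! i)"
    if "\<omega> \<in> space (P x)" "\<forall>i<n. X i \<omega> \<in> D i" for \<omega>
    using that X_in_S[OF x] by (auto simp: L_def)
  have disj: "disjoint_family_on ev L" "disjoint_family_on ev' L"
    by (auto simp: disjoint_family_on_def ev_def ev'_def L_def intro!: nth_equalityI)
  have one: "emeasure (P x) (ev' l) = emeasure (P x) (ev l) * ennreal (q w z)" if "l \<in> L" for l
  proof -
    define s where "s i = (if i < n then l ! i else if i = n then w else z)" for i
    have le: "(\<forall>i\<le>m. Q i) \<longleftrightarrow> (\<forall>i<m. Q i) \<and> Q m" "(\<forall>i<Suc m. Q i) \<longleftrightarrow> (\<forall>i<m. Q i) \<and> Q m"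
      for Q and m :: nat
      by (auto simp: le_less less_Suc_eq)
    have "ev l = {\<omega> \<in> space (P x). \<forall>i\<le>n. X i \<omega> = s i}"
      "ev' l = {\<omega> \<in> space (P x). \<forall>i\<le>Suc n. X i \<omega> = s i}"
      unfolding le by (simp_all add: ev_def ev'_def s_def conj_assoc)
    moreover have "s i \<in> S" if "i \<le> Suc n" for i
      using \<open>l \<in> L\<close> w z by (auto simp: s_def L_def)
    ultimately show ?thesis
      using path_probability[OF x, of n s] by (simp add: s_def)
  qed
  have "{\<omega> \<in> space (P x). (\<forall>i<n. X i \<omega> \<in> D i) \<and> X n \<omega> = w \<and> X (Suc n) \<omega> = z} = (\<Union>l\<in>L. ev' l)"
    using ex by (fastforce simp: ev'_def L_def)
  then have "emeasure (P x) {\<omega> \<in> space (P x). (\<forall>i<n. X i \<omega> \<in> D i) \<and> X n \<omega> = w \<and> X (Suc n) \<omega> = z}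
      = (\<integral>\<^sup>+l. emeasure (P x) (ev' l) \<partial>count_space L)"
    using emeasure_UN_countable[of L ev' "P x", OF _ L disj(2)] by (simp add: ev'_def)
  also have "\<dots> = (\<integral>\<^sup>+l. emeasure (P x) (ev l) * ennreal (q w z) \<partial>count_space L)"
    by (intro nn_integral_cong) (simp add: one)
  also have "\<dots> = (\<integral>\<^sup>+l. emeasure (P x) (ev l) \<partial>count_space L) * ennreal (q w z)"
    by (rule nn_integral_multc) simp
  also have "(\<integral>\<^sup>+l. emeasure (P x) (ev l) \<partial>count_space L) = emeasure (P x) (\<Union>l\<in>L. ev l)"
    using emeasure_UN_countable[of L ev "P x", OF _ L disj(1)] by (simp add: ev_def)
  also have "(\<Union>l\<in>L. ev l) = {\<omega> \<in> space (P x). (\<forall>i<n. X i \<omega> \<in> D i) \<and> X n \<omega> = w}"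
    using ex by (fastforce simp: ev_def L_def)
  finally show ?thesis .
qed

lemma AE_X_0: "x \<in> S \<Longrightarrow> AE \<omega> in P x. X 0 \<omega> = x"
proof -
  assume x: "x \<in> S"
  interpret prob_space "P x" by (rule prob_space_P[OF x])
  note [measurable] = pred_X_eq[OF x]
  have "\<P>(\<omega> in P x. X 0 \<omega> = x) = 1" using chain x by (simp add: markov_chain_def)
  then show ?thesis by (subst (asm) prob_Collect_eq_1) auto
qed

lemma taboo_prob_0:
  assumes x: "x \<in> S"
  shows "taboo_prob P X B x 0 z = indicator {x} z"
proof -
  interpret prob_space "P x" by (rule prob_space_P[OF x])
  note [measurable] = pred_X_eq[OF x]
  show ?thesis
  proof (cases "z = x")
    case True
    have "emeasure (P x) {\<omega> \<in> space (P x). X 0 \<omega> = x} = 1"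
      using AE_X_0[OF x] by (intro emeasure_eq_1_AE) auto
    with True show ?thesis by (simp add: taboo_prob_def)
  next
    case False
    have "AE \<omega> in P x. X 0 \<omega> \<noteq> z" using AE_X_0[OF x] False by auto
    then have "emeasure (P x) {\<omega> \<in> space (P x). X 0 \<omega> = z} = 0"
      by (intro emeasure_eq_0_AE) auto
    with False show ?thesis by (simp add: taboo_prob_def)
  qed
qed

text \<open>The event is split by the position \<open>w\<close> at time \<open>n\<close>. That time
  is now intermediate, so \<open>w\<close> must lie in \<open>B\<close>, except for
  \<open>n = 0\<close>, since time 0 is never constrained.\<close>

lemma taboo_prob_Suc:
  assumes x: "x \<in> S" and z: "z \<in> S"
  shows "taboo_prob P X B x (Suc n) z =
    (\<integral>\<^sup>+w. (if n = 0 \<or> w \<in> B then taboo_prob P X B x n w * ennreal (q w z) else 0) \<partial>count_space S)"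
proof -
  note [measurable] = pred_X_eq[OF x] pred_X[OF x]
  define D where "D i = (if i = 0 then UNIV else B)" for i :: nat
  define ev where "ev w = {\<omega> \<in> space (P x). (n = 0 \<or> w \<in> B) \<and>
      (\<forall>i<n. X i \<omega> \<in> D i) \<and> X n \<omega> = w \<and> X (Suc n) \<omega> = z}" for w
  have D: "(\<forall>i<n. X i \<omega> \<in> D i) \<longleftrightarrow> (\<forall>i. 0 < i \<and> i < n \<longrightarrow> X i \<omega> \<in> B)" for n \<omega>
    by (auto simp: D_def)
  have "{\<omega> \<in> space (P x). (\<forall>i. 0 < i \<and> i < Suc n \<longrightarrow> X i \<omega> \<in> B) \<and> X (Suc n) \<omega> = z} = (\<Union>w\<in>S. ev w)"
    using X_in_S[OF x] by (auto simp: ev_def D less_Suc_eq)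
  then have "taboo_prob P X B x (Suc n) z = emeasure (P x) (\<Union>w\<in>S. ev w)"
    by (simp add: taboo_prob_def)
  also have "\<dots> = (\<integral>\<^sup>+w. emeasure (P x) (ev w) \<partial>count_space S)"
    using countable_S by (intro emeasure_UN_countable) (auto simp: ev_def disjoint_family_on_def)
  also have "\<dots> = (\<integral>\<^sup>+w. (if n = 0 \<or> w \<in> B then taboo_prob P X B x n w * ennreal (q w z) else 0) \<partial>count_space S)"
  proof (rule nn_integral_cong)
    fix w assume "w \<in> space (count_space S)"
    then show "emeasure (P x) (ev w) =
        (if n = 0 \<or> w \<in> B then taboo_prob P X B x n w * ennreal (q w z) else 0)"
      using markov_step[OF x _ z, of w n D] by (auto simp: ev_def taboo_prob_def D)
  qed
  finally show ?thesis .
qed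

text \<open>The exception at time 0 disappears because the start lies in \<open>B\<close>; states of
  \<open>B\<close> outside \<open>D\<close> contribute nothing because they cannot step to
  \<open>z\<close>.\<close>

lemma taboo_prob_Suc_on:
  assumes x: "x \<in> S" and z: "z \<in> S" and D: "D \<subseteq> S \<inter> B"
    and "\<And>w. w \<in> S \<inter> B - D \<Longrightarrow> q w z = 0" and "x \<in> B"
  shows "taboo_prob P X B x (Suc n) z =
    (\<integral>\<^sup>+w. taboo_prob P X B x n w * ennreal (q w z) \<partial>count_space D)"
proof -
  have *: "taboo_prob P X B x n w * ennreal (q w z) = 0" if "w \<in> S - D" "n = 0 \<or> w \<in> B" for w
    using that assms(4)[of w] \<open>x \<in> B\<close> by (cases "w \<in> B") (auto simp: taboo_prob_0[OF x] indicator_def)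
  have "taboo_prob P X B x (Suc n) z =
    (\<integral>\<^sup>+w. (if n = 0 \<or> w \<in> B then taboo_prob P X B x n w * ennreal (q w z) else 0) \<partial>count_space D)"
    unfolding taboo_prob_Suc[OF x z] using D *
    by (intro nn_integral_count_space_eq) auto
  also have "\<dots> = (\<integral>\<^sup>+w. taboo_prob P X B x n w * ennreal (q w z) \<partial>count_space D)"
    using D by (intro nn_integral_cong) auto
  finally show ?thesis .
qed

text \<open>Along a path inside the image of \<open>E\<close> the ratios \<open>k z / k w\<close>
  telescope to the factors at the two ends; \<open>null\<close> excludes entry from elsewhere in
  \<open>B\<close>. It is used with \<open>k = 1\<close> for the killed chain and its translate, and
  with \<open>k z = h (z \<otimes> u)\<close> for the \<open>h\<close>-transform.\<close>

lemma taboo_prob_embedded: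
  assumes inj: "inj_on \<phi> E" and img: "\<phi> ` E \<subseteq> S \<inter> B"
    and null: "\<And>w z. w \<in> S \<inter> B - \<phi> ` E \<Longrightarrow> z \<in> E \<Longrightarrow> q w (\<phi> z) = 0"
    and k: "\<And>z. z \<in> E \<Longrightarrow> 0 < k z"
    and p: "\<And>w z. w \<in> E \<Longrightarrow> z \<in> E \<Longrightarrow> q (\<phi> w) (\<phi> z) = p w z * k z / k w"
    and p0: "\<And>w z. w \<in> E \<Longrightarrow> z \<in> E \<Longrightarrow> 0 \<le> p w z"
    and x: "x \<in> E"
  shows "z \<in> E \<Longrightarrow>
    taboo_prob P X B (\<phi> x) n (\<phi> z) * ennreal (k x) = step_kernel E p n x z * ennreal (k z)"
proof (induction n arbitrary: z)
  case 0
  then show ?case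
    using inj img x by (subst taboo_prob_0) (auto simp: indicator_def inj_on_def)
next
  case (Suc n)
  have S: "\<phi> x \<in> S" "\<phi> z \<in> S" "\<phi> x \<in> B" using img x Suc.prems by auto
  have "taboo_prob P X B (\<phi> x) (Suc n) (\<phi> z) =
      (\<integral>\<^sup>+w. taboo_prob P X B (\<phi> x) n w * ennreal (q w (\<phi> z)) \<partial>count_space (\<phi> ` E))"
    using null Suc.prems img S by (intro taboo_prob_Suc_on) auto
  also have "\<dots> = (\<integral>\<^sup>+w. taboo_prob P X B (\<phi> x) n (\<phi> w) * ennreal (q (\<phi> w) (\<phi> z)) \<partial>count_space E)"
    using inj by (intro nn_integral_bij_count_space[symmetric]) (auto simp: bij_betw_def)
  finally have "taboo_prob P X B (\<phi> x) (Suc n) (\<phi> z) * ennreal (k x) =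
      (\<integral>\<^sup>+w. taboo_prob P X B (\<phi> x) n (\<phi> w) * ennreal (q (\<phi> w) (\<phi> z)) * ennreal (k x) \<partial>count_space E)"
    by (simp add: nn_integral_multc)
  also have "\<dots> = (\<integral>\<^sup>+w. step_kernel E p n x w * ennreal (p w z) * ennreal (k z) \<partial>count_space E)"
  proof (rule nn_integral_cong)
    fix w assume "w \<in> space (count_space E)"
    then have w: "w \<in> E" by simp
    have "ennreal (k w) * ennreal (q (\<phi> w) (\<phi> z)) = ennreal (p w z) * ennreal (k z)"
      using k[OF w] k[OF Suc.prems] p0[OF w Suc.prems]
      by (simp add: p[OF w Suc.prems] ennreal_mult'[symmetric])
    then show "taboo_prob P X B (\<phi> x) n (\<phi> w) * ennreal (q (\<phi> w) (\<phi> z)) * ennreal (k x) =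
        step_kernel E p n x w * ennreal (p w z) * ennreal (k z)"
      using Suc.IH[OF w] by (metis mult.assoc mult.commute)
  qed
  also have "\<dots> = step_kernel E p (Suc n) x z * ennreal (k z)"
    by (simp add: nn_integral_multc)
  finally show ?case .
qed

end

section \<open>Harmonic functions and the translation by \<open>u\<close>\<close>

locale shift_kernel =
  fixes \<G> :: "('a, 'm) monoid_scheme" (structure) and E :: "'a set" and p :: "'a \<Rightarrow> 'a \<Rightarrow> real" and u :: 'a
  assumes group_G: "group \<G>"
    and E_carrier: "E \<subseteq> carrier \<G>"
    and countable_E: "countable E"
    and p_nonneg: "x \<in> E \<Longrightarrow> y \<in> E \<Longrightarrow> 0 \<le> p x y"
    and u_in: "u \<in> E"
    and coset_subset: "E #> u \<subseteq> E"
    and p_shift: "x \<in> E \<Longrightarrow> y \<in> E \<Longrightarrow> p (x \<otimes> u) (y \<otimes> u) = p x y"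
begin

lemma coset_eq: "E #> u = (\<lambda>y. y \<otimes> u) ` E"
  by (auto simp: r_coset_def)

lemma shift_in: "x \<in> E \<Longrightarrow> x \<otimes> u \<in> E"
  using coset_subset by (auto simp: coset_eq)

lemma inj_shift: "inj_on (\<lambda>y. y \<otimes> u) E"
  using group.inj_on_multc[OF group_G, of u] u_in E_carrier by (auto intro: inj_on_subset)

lemma bij_shift: "bij_betw (\<lambda>y. y \<otimes> u) E (E #> u)"
  by (simp add: bij_betw_def inj_shift coset_eq)

definition shift :: "('a \<Rightarrow> 'c) \<Rightarrow> 'a \<Rightarrow> 'c" where
  "shift F x = F (x \<otimes> u)"

lemma shift_funpow_Suc: "(shift ^^ Suc n) F x = (shift ^^ n) F (x \<otimes> u)"
proof -
  have "(shift ^^ Suc n) F x = shift ((shift ^^ n) F) x" by simp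
  then show ?thesis by (simp only: shift_def)
qed

lemma shift_funpow: "x \<in> E \<Longrightarrow> (shift ^^ n) F x = F (x \<otimes> u [^] n)"
proof (induction n arbitrary: x)
  case 0
  then show ?case using E_carrier group_G by (auto simp: group.is_monoid monoid.r_one monoid.nat_pow_0)
next
  case (Suc n)
  interpret group \<G> by (rule group_G)
  have "(shift ^^ Suc n) F x = F ((x \<otimes> u) \<otimes> u [^] n)"
    unfolding shift_funpow_Suc by (rule Suc.IH[OF shift_in[OF Suc.prems]])
  also have "(x \<otimes> u) \<otimes> u [^] n = x \<otimes> u [^] Suc n"
    using E_carrier Suc.prems u_in by (simp add: m_assoc subset_iff flip: nat_pow_Suc2)
  finally show ?case .
qed

lemma shift_pow_in: "x \<in> E \<Longrightarrow> x \<otimes> u [^] (n :: nat) \<in> E"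
proof (induction n arbitrary: x)
  case 0
  interpret group \<G> by (rule group_G)
  show ?case using 0 E_carrier by auto
next
  case (Suc n)
  interpret group \<G> by (rule group_G)
  have "(x \<otimes> u) \<otimes> u [^] n = x \<otimes> u [^] Suc n"
    using E_carrier Suc.prems u_in by (simp add: m_assoc subset_iff flip: nat_pow_Suc2)
  then show ?case using Suc.IH[OF shift_in[OF Suc.prems]] by simp
qed

section \<open>The transition operator against the translation\<close>

lemma trans_op_mono: "(\<And>y. y \<in> E \<Longrightarrow> F y \<le> H y) \<Longrightarrow> trans_op E p F x \<le> trans_op E p H x"
  unfolding trans_op_def by (intro nn_integral_mono mult_left_mono) auto

lemma trans_op_funpow_mono:
  "(\<And>y. y \<in> E \<Longrightarrow> F y \<le> H y) \<Longrightarrow> x \<in> E \<Longrightarrow> (trans_op E p ^^ n) F x \<le> (trans_op E p ^^ n) H x"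
  by (induction n arbitrary: x) (auto intro: trans_op_mono)

text \<open>The substitution \<open>z = y \<otimes> u\<close> identifies the left side with the
  jumps from \<open>x \<otimes> u\<close> landing in \<open>E #> u\<close>; the right side also
  counts those leaving that set. Hence translates of harmonic functions are superharmonic.\<close>

lemma trans_op_shift_le:
  assumes "x \<in> E"
  shows "trans_op E p (shift F) x \<le> trans_op E p F (x \<otimes> u)"
proof -
  have "trans_op E p (shift F) x =
      (\<integral>\<^sup>+y. ennreal (p (x \<otimes> u) (y \<otimes> u)) * F (y \<otimes> u) \<partial>count_space E)"
    unfolding trans_op_def using p_shift[OF assms] by (intro nn_integral_cong) (auto simp: shift_def)
  also have "\<dots> = (\<integral>\<^sup>+z. ennreal (p (x \<otimes> u) z) * F z \<partial>count_space (E #> u))"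
    by (rule nn_integral_bij_count_space[OF bij_shift])
  also have "\<dots> \<le> trans_op E p F (x \<otimes> u)"
    unfolding trans_op_def using coset_subset
    by (auto simp: nn_integral_count_space_indicator split: split_indicator intro!: nn_integral_mono)
  finally show ?thesis .
qed

lemma trans_op_funpow_shift_le:
  "x \<in> E \<Longrightarrow> (trans_op E p ^^ k) (shift F) x \<le> (trans_op E p ^^ k) F (x \<otimes> u)"
proof (induction k arbitrary: x)
  case (Suc k)
  have "(trans_op E p ^^ Suc k) (shift F) x \<le> trans_op E p (shift ((trans_op E p ^^ k) F)) x"
  proof -
    have "(trans_op E p ^^ k) (shift F) y \<le> shift ((trans_op E p ^^ k) F) y" if "y \<in> E" for y
      unfolding shift_def[of "(trans_op E p ^^ k) F" y] by (rule Suc.IH[OF that])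
    then show ?thesis by (auto intro: trans_op_mono)
  qed
  also have "\<dots> \<le> (trans_op E p ^^ Suc k) F (x \<otimes> u)"
    using trans_op_shift_le[OF Suc.prems] by simp
  finally show ?case .
qed (simp add: shift_def)

lemma trans_op_funpow_shift_funpow_le:
  "x \<in> E \<Longrightarrow> (trans_op E p ^^ k) ((shift ^^ n) F) x \<le> (shift ^^ n) ((trans_op E p ^^ k) F) x"
proof (induction n arbitrary: x)
  case (Suc n)
  have "(trans_op E p ^^ k) ((shift ^^ Suc n) F) x \<le> (trans_op E p ^^ k) ((shift ^^ n) F) (x \<otimes> u)"
    using trans_op_funpow_shift_le[OF Suc.prems] by simp
  also have "\<dots> \<le> (shift ^^ n) ((trans_op E p ^^ k) F) (x \<otimes> u)"
    by (rule Suc.IH[OF shift_in[OF Suc.prems]])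
  finally show ?case unfolding shift_funpow_Suc[of n "(trans_op E p ^^ k) F" x] .
qed simp

section \<open>Linearity and the cone of harmonic functions\<close>

lemma trans_op_funpow_comb:
  "x \<in> E \<Longrightarrow> (trans_op E p ^^ k) (\<lambda>y. a * F y + b * H y) x =
     a * (trans_op E p ^^ k) F x + b * (trans_op E p ^^ k) H x"
  by (simp add: trans_op_funpow[OF countable_E] distrib_left nn_integral_add mult.left_commute nn_integral_cmult)

definition harmonic_cone :: "('a \<Rightarrow> real) set" where
  "harmonic_cone = {f. (\<forall>x. 0 \<le> f x) \<and> (\<forall>x. x \<notin> E \<longrightarrow> f x = 0) \<and>
     (\<forall>x\<in>E. trans_op E p (\<lambda>y. ennreal (f y)) x = ennreal (f x))}"

lemma harmonic_coneD:
  assumes "f \<in> harmonic_cone"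
  shows "0 \<le> f x" "x \<notin> E \<Longrightarrow> f x = 0" "x \<in> E \<Longrightarrow> trans_op E p (\<lambda>y. ennreal (f y)) x = ennreal (f x)"
  using assms by (auto simp: harmonic_cone_def)

lemma trans_op_funpow_harmonic:
  assumes "f \<in> harmonic_cone"
  shows "x \<in> E \<Longrightarrow> (trans_op E p ^^ k) (\<lambda>y. ennreal (f y)) x = ennreal (f x)"
proof (induction k arbitrary: x)
  case (Suc k)
  have "trans_op E p ((trans_op E p ^^ k) (\<lambda>y. ennreal (f y))) x = trans_op E p (\<lambda>y. ennreal (f y)) x"
    by (intro antisym trans_op_mono) (simp_all add: Suc.IH)
  then show ?case using harmonic_coneD(3)[OF assms Suc.prems] by simp
qed simp

sublocale function_cone harmonic_cone
proof
  show "0 \<le> f x" if "f \<in> harmonic_cone" for f x using that by (rule harmonic_coneD)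
  show "(\<lambda>x. a * f x + b * g x) \<in> harmonic_cone"
    if "f \<in> harmonic_cone" "g \<in> harmonic_cone" "0 \<le> a" "0 \<le> b" for f g a b
    using trans_op_funpow_comb[of _ 1 "ennreal a" "\<lambda>y. ennreal (f y)" "ennreal b" "\<lambda>y. ennreal (g y)"] that
    by (auto simp: harmonic_cone_def ennreal_mult ennreal_plus)
  show "(\<lambda>x. g x - f x) \<in> harmonic_cone"
    if f: "f \<in> harmonic_cone" and g: "g \<in> harmonic_cone" and le: "\<And>x. f x \<le> g x" for f g
  proof -
    have "trans_op E p (\<lambda>y. ennreal (g y - f y)) x = ennreal (g x - f x)" if x: "x \<in> E" for x
    proof -
      \<comment> \<open>Splitting \<open>g = f + (g - f)\<close> first reduces the claim to
        cancelling the finite value \<open>f x\<close>.\<close>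
      have "ennreal (g x) = trans_op E p (\<lambda>y. 1 * ennreal (f y) + 1 * ennreal (g y - f y)) x"
        using harmonic_coneD(1)[OF f] le
        by (simp add: ennreal_plus[symmetric] harmonic_coneD(3)[OF g x] del: ennreal_plus)
      also have "\<dots> = ennreal (f x) + trans_op E p (\<lambda>y. ennreal (g y - f y)) x"
        using trans_op_funpow_comb[OF x, of 1 1 _ 1] by (simp add: harmonic_coneD(3)[OF f x])
      finally show ?thesis
        by (metis ennreal_add_diff_cancel_left ennreal_minus ennreal_neq_top harmonic_coneD(1)[OF f])
    qed
    then show ?thesis
      using le harmonic_coneD(2)[OF f] harmonic_coneD(2)[OF g] by (auto simp: harmonic_cone_def)
  qed
qed

section \<open>The largest harmonic minorant of a translate\<close>

text \<open>The largest harmonic minorant of \<open>x \<mapsto> f (x \<star> u)\<close>.\<close>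

definition shift_minorant :: "('a \<Rightarrow> real) \<Rightarrow> 'a \<Rightarrow> real" where
  "shift_minorant f x =
     (if x \<in> E then enn2real (INF k. (trans_op E p ^^ k) (shift (\<lambda>y. ennreal (f y))) x) else 0)"

text \<open>The translate of \<open>f\<close> is superharmonic, and monotonicity of
  \<open>trans_op\<close> carries this first inequality to all iterates.\<close>

lemma decseq_trans_op_shift:
  assumes f: "f \<in> harmonic_cone" and x: "x \<in> E"
  shows "decseq (\<lambda>k. (trans_op E p ^^ k) (shift (\<lambda>y. ennreal (f y))) x)"
proof (rule decseq_SucI)
  show "(trans_op E p ^^ Suc k) (shift (\<lambda>y. ennreal (f y))) x \<le>
      (trans_op E p ^^ k) (shift (\<lambda>y. ennreal (f y))) x" for k
    using x
  proof (induction k arbitrary: x)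
    case 0
    then show ?case
    proof -
      have "trans_op E p (shift (\<lambda>y. ennreal (f y))) x \<le> ennreal (f (x \<otimes> u))"
        using trans_op_shift_le[OF 0, of "\<lambda>y. ennreal (f y)"] harmonic_coneD(3)[OF f shift_in[OF 0]]
        by simp
      also have "\<dots> = shift (\<lambda>y. ennreal (f y)) x" by (simp only: shift_def)
      finally show ?thesis by simp
    qed
  next
    case (Suc k)
    show ?case using trans_op_mono[OF Suc.IH] by simp
  qed
qed

lemma trans_op_shift_bound:
  assumes f: "f \<in> harmonic_cone" and x: "x \<in> E"
  shows "(trans_op E p ^^ k) (shift (\<lambda>y. ennreal (f y))) x \<le> ennreal (f (x \<otimes> u))"
proof -
  have "(trans_op E p ^^ k) (shift (\<lambda>y. ennreal (f y))) x \<le> shift (\<lambda>y. ennreal (f y)) x"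
    using decseqD[OF decseq_trans_op_shift[OF f x], of 0 k] by simp
  then show ?thesis unfolding shift_def[of "\<lambda>y. ennreal (f y)" x] .
qed

text \<open>The terms are bounded by \<open>f (x \<otimes> u)\<close>, so the infimum is finite and
  \<open>enn2real\<close> loses nothing.\<close>

lemma ennreal_shift_minorant:
  assumes f: "f \<in> harmonic_cone" and x: "x \<in> E"
  shows "ennreal (shift_minorant f x) = (INF k. (trans_op E p ^^ k) (shift (\<lambda>y. ennreal (f y))) x)"
proof -
  have "(INF k. (trans_op E p ^^ k) (shift (\<lambda>y. ennreal (f y))) x) \<le> ennreal (f (x \<otimes> u))"
    by (rule INF_lower2[of 0]) (use trans_op_shift_bound[OF f x, of 0] in auto)
  then have "(INF k. (trans_op E p ^^ k) (shift (\<lambda>y. ennreal (f y))) x) < \<infinity>"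
    by (rule le_less_trans) simp
  then show ?thesis using x by (simp add: shift_minorant_def)
qed

lemma tendsto_shift_minorant:
  assumes f: "f \<in> harmonic_cone" and x: "x \<in> E"
  shows "(\<lambda>k. (trans_op E p ^^ k) (shift (\<lambda>y. ennreal (f y))) x) \<longlonglongrightarrow> ennreal (shift_minorant f x)"
  unfolding ennreal_shift_minorant[OF f x] by (rule LIMSEQ_INF[OF decseq_trans_op_shift[OF f x]])

lemma shift_minorant_nonneg: "0 \<le> shift_minorant f x"
  by (simp add: shift_minorant_def)

lemma shift_minorant_le:
  assumes f: "f \<in> harmonic_cone" and x: "x \<in> E"
  shows "shift_minorant f x \<le> f (x \<otimes> u)"
proof -
  have "ennreal (shift_minorant f x) \<le> ennreal (f (x \<otimes> u))"
    unfolding ennreal_shift_minorant[OF f x]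
    by (rule INF_lower2[of 0]) (use trans_op_shift_bound[OF f x, of 0] in auto)
  then show ?thesis using harmonic_coneD(1)[OF f] by simp
qed

text \<open>Applying \<open>trans_op\<close> to the defining sequence moves its index by one and
  keeps the limit, while dominated convergence takes the limit inside. The domination by the
  translate of \<open>f\<close> is summable by \<open>trans_op_shift_bound\<close>.\<close>

lemma shift_minorant_in:
  assumes f: "f \<in> harmonic_cone"
  shows "shift_minorant f \<in> harmonic_cone"
proof -
  let ?F = "shift (\<lambda>y. ennreal (f y))"
  have "trans_op E p (\<lambda>y. ennreal (shift_minorant f y)) x = ennreal (shift_minorant f x)" if x: "x \<in> E" for x
  proof (rule LIMSEQ_unique)
    have fin: "trans_op E p ?F x < \<infinity>"
      using trans_op_shift_bound[OF f x, of 1] by (auto intro: le_less_trans)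
    show "(\<lambda>k. trans_op E p ((trans_op E p ^^ k) ?F) x) \<longlonglongrightarrow> trans_op E p (\<lambda>y. ennreal (shift_minorant f y)) x"
      unfolding trans_op_def[of E p _ x]
    proof (rule nn_integral_dominated_convergence[where w="\<lambda>y. ennreal (p x y) * ?F y"])
      show "(\<integral>\<^sup>+y. ennreal (p x y) * ?F y \<partial>count_space E) < \<infinity>"
        using fin by (simp add: trans_op_def)
      show "AE y in count_space E. ennreal (p x y) * (trans_op E p ^^ k) ?F y \<le> ennreal (p x y) * ?F y" for k
        using trans_op_shift_bound[OF f] by (auto simp: AE_count_space shift_def intro: mult_left_mono)
      show "AE y in count_space E. (\<lambda>k. ennreal (p x y) * (trans_op E p ^^ k) ?F y)
          \<longlonglongrightarrow> ennreal (p x y) * ennreal (shift_minorant f y)"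
        using tendsto_shift_minorant[OF f] by (auto simp: AE_count_space intro: ennreal_tendsto_cmult)
    qed auto
    show "(\<lambda>k. trans_op E p ((trans_op E p ^^ k) ?F) x) \<longlonglongrightarrow> ennreal (shift_minorant f x)"
      using LIMSEQ_Suc[OF tendsto_shift_minorant[OF f x]] by simp
  qed
  then show ?thesis by (auto simp: harmonic_cone_def shift_minorant_def)
qed

text \<open>An infimum need not be additive, but along a decreasing sequence it is a limit, and
  limits respect the linear combination.\<close>

lemma cone_operator_shift_minorant: "cone_operator shift_minorant"
  unfolding cone_operator_def
proof (intro conjI ballI allI impI ext)
  fix f g and a b :: real and x
  assume fg: "f \<in> harmonic_cone" "g \<in> harmonic_cone" and ab: "0 \<le> a" "0 \<le> b"
  let ?h = "\<lambda>x. a * f x + b * g x"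
  show "shift_minorant ?h x = a * shift_minorant f x + b * shift_minorant g x"
  proof (cases "x \<in> E")
    case True
    have h: "?h \<in> harmonic_cone" using fg ab by (rule cone_comb)
    have eq: "shift (\<lambda>y. ennreal (?h y)) =
        (\<lambda>y. ennreal a * shift (\<lambda>y. ennreal (f y)) y + ennreal b * shift (\<lambda>y. ennreal (g y)) y)"
      using fg ab by (auto simp: fun_eq_iff shift_def ennreal_mult harmonic_coneD)
    have "(\<lambda>k. (trans_op E p ^^ k) (shift (\<lambda>y. ennreal (?h y))) x)
        \<longlonglongrightarrow> ennreal a * ennreal (shift_minorant f x) + ennreal b * ennreal (shift_minorant g x)"
      unfolding eq trans_op_funpow_comb[OF True]
      by (intro tendsto_add ennreal_tendsto_cmult tendsto_shift_minorant fg True) auto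
    from LIMSEQ_unique[OF tendsto_shift_minorant[OF h True] this]
    have "ennreal (shift_minorant ?h x) = ennreal (a * shift_minorant f x + b * shift_minorant g x)"
      using ab by (simp add: ennreal_mult shift_minorant_nonneg)
    then show ?thesis using ab by (simp add: shift_minorant_nonneg del: ennreal_plus)
  qed (simp add: shift_minorant_def)
qed (rule shift_minorant_in)

lemma shift_minorant_funpow_in: "f \<in> harmonic_cone \<Longrightarrow> (shift_minorant ^^ n) f \<in> harmonic_cone"
  using cone_operator_in[OF cone_operator_funpow[OF cone_operator_shift_minorant]] .

lemma shift_minorant_funpow_le:
  assumes f: "f \<in> harmonic_cone" and x: "x \<in> E"
  shows "(shift_minorant ^^ n) f x \<le> f (x \<otimes> u [^] n)"
proof -
  have "(shift_minorant ^^ n) f x \<le> (shift ^^ n) f x" using x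
  proof (induction n arbitrary: x)
    case (Suc n)
    have "(shift_minorant ^^ Suc n) f x \<le> (shift_minorant ^^ n) f (x \<otimes> u)"
      using shift_minorant_le[OF shift_minorant_funpow_in[OF f] Suc.prems] by simp
    also have "\<dots> \<le> (shift ^^ n) f (x \<otimes> u)" by (rule Suc.IH[OF shift_in[OF Suc.prems]])
    finally show ?case by (simp only: shift_funpow_Suc)
  qed simp
  then show ?thesis by (simp add: shift_funpow[OF x])
qed

text \<open>Every power of \<open>trans_op\<close> fixes \<open>g\<close>, so \<open>g\<close> stays
  below that power of the \<open>(n+1)\<close>-fold translate of \<open>f\<close>. Moving the power
  past \<open>n\<close> translations costs only an inequality; the infimum over \<open>k\<close>
  then puts \<open>g\<close> below the \<open>n\<close>-fold translate of
  \<open>shift_minorant f\<close>, with which the induction continues.\<close>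

lemma shift_minorant_funpow_greatest:
  assumes g: "g \<in> harmonic_cone"
  shows "f \<in> harmonic_cone \<Longrightarrow> (\<And>x. x \<in> E \<Longrightarrow> g x \<le> f (x \<otimes> u [^] n)) \<Longrightarrow> g x \<le> (shift_minorant ^^ n) f x"
proof (induction n arbitrary: f x)
  case 0
  interpret group \<G> by (rule group_G)
  show ?case
    using "0.prems"(2)[of x] harmonic_coneD(2)[OF g, of x] harmonic_coneD(2)[OF "0.prems"(1), of x] E_carrier
    by (cases "x \<in> E") auto
next
  case (Suc n)
  let ?F = "\<lambda>y. ennreal (f y)"
  have "g x \<le> shift_minorant f (x \<otimes> u [^] n)" if x: "x \<in> E" for x
  proof -
    have "ennreal (g x) \<le> (trans_op E p ^^ k) (shift ?F) (x \<otimes> u [^] n)" for k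
    proof -
      have "ennreal (g x) = (trans_op E p ^^ k) (\<lambda>y. ennreal (g y)) x"
        by (rule trans_op_funpow_harmonic[OF g x, symmetric])
      also have "\<dots> \<le> (trans_op E p ^^ k) ((shift ^^ n) (shift ?F)) x"
      proof (rule trans_op_funpow_mono[OF _ x])
        fix y assume y: "y \<in> E"
        have "(shift ^^ n) (shift ?F) y = ?F (y \<otimes> u [^] Suc n)"
          using shift_funpow[OF y, of "Suc n" ?F] by (simp add: funpow_swap1)
        then show "ennreal (g y) \<le> (shift ^^ n) (shift ?F) y"
          using Suc.prems(2)[OF y] by (simp add: ennreal_leI)
      qed
      also have "\<dots> \<le> (trans_op E p ^^ k) (shift ?F) (x \<otimes> u [^] n)"
        using trans_op_funpow_shift_funpow_le[OF x, of k n "shift ?F"] by (simp add: shift_funpow[OF x])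
      finally show ?thesis .
    qed
    then have "ennreal (g x) \<le> ennreal (shift_minorant f (x \<otimes> u [^] n))"
      unfolding ennreal_shift_minorant[OF Suc.prems(1) shift_pow_in[OF x]] by (rule INF_greatest)
    then show ?thesis by (simp add: shift_minorant_nonneg)
  qed
  from Suc.IH[OF shift_minorant_in[OF Suc.prems(1)] this]
  show ?case by (simp add: funpow_swap1)
qed

text \<open>By the lower bound \<open>exp (- \<epsilon> n) f\<close> is a harmonic minorant of the
  \<open>n\<close>-fold translate, hence below the iterate of \<open>shift_minorant\<close>, which
  is the largest one. The upper bound holds because the iterate is below the translate.\<close>

lemma shift_minorant_eq:
  assumes slow: "\<And>\<epsilon>. 0 < \<epsilon> \<Longrightarrow> \<exists>N::nat. \<forall>n\<ge>N. \<forall>f\<in>harmonic_cone. \<forall>x\<in>E.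
      exp (- \<epsilon> * real n) * f x \<le> f (x \<otimes> u [^] n) \<and> f (x \<otimes> u [^] n) \<le> exp (\<epsilon> * real n) * f x"
    and f: "f \<in> harmonic_cone"
  shows "shift_minorant f = f"
proof (rule cone_operator_eq_id[OF cone_operator_shift_minorant _ f])
  fix \<epsilon> :: real assume "0 < \<epsilon>"
  from slow[OF this] obtain N :: nat where N: "\<And>n f x. n \<ge> N \<Longrightarrow> f \<in> harmonic_cone \<Longrightarrow> x \<in> E \<Longrightarrow>
      exp (- \<epsilon> * real n) * f x \<le> f (x \<otimes> u [^] n) \<and> f (x \<otimes> u [^] n) \<le> exp (\<epsilon> * real n) * f x"
    by blast
  have "exp (- \<epsilon> * real n) * f x \<le> (shift_minorant ^^ n) f x \<and> (shift_minorant ^^ n) f x \<le> exp (\<epsilon> * real n) * f x"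
    if n: "n \<ge> N" and f: "f \<in> harmonic_cone" for n f x
  proof
    show "exp (- \<epsilon> * real n) * f x \<le> (shift_minorant ^^ n) f x"
      using N[OF n f] by (intro shift_minorant_funpow_greatest[OF cone_scale[OF f] f]) auto
    show "(shift_minorant ^^ n) f x \<le> exp (\<epsilon> * real n) * f x"
    proof (cases "x \<in> E")
      case True
      then show ?thesis
        using shift_minorant_funpow_le[OF f True, of n] N[OF n f True] by linarith
    next
      case False
      then show ?thesis
        using harmonic_coneD(2)[OF shift_minorant_funpow_in[OF f]] harmonic_coneD(2)[OF f] by simp
    qed
  qed
  then show "\<exists>N::nat. \<forall>n\<ge>N. \<forall>f\<in>harmonic_cone. \<forall>x. exp (- \<epsilon> * real n) * f x \<le> (shift_minorant ^^ n) f x \<and>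
      (shift_minorant ^^ n) f x \<le> exp (\<epsilon> * real n) * f x"
    by blast
qed

end

section \<open>The killed chain\<close>

lemma nn_integral_count_space_Times:
  assumes A: "countable A" and B: "countable B"
  shows "(\<integral>\<^sup>+c. f c \<partial>count_space (A \<times> B)) = (\<integral>\<^sup>+a. \<integral>\<^sup>+b. f (a, b) \<partial>count_space B \<partial>count_space A)"
proof -
  interpret sigma_finite_measure "count_space B"
    using B by (rule sigma_finite_measure_count_space_countable)
  show ?thesis
    using nn_integral_fst[of f "count_space A"] by (simp add: pair_measure_countable[OF A B])
qed

lemma hit_time_eq_enat_iff:
  "hit_time D w = enat m \<longleftrightarrow> 1 \<le> m \<and> w m \<in> D \<and> (\<forall>i. 1 \<le> i \<and> i < m \<longrightarrow> w i \<notin> D)"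
proof
  assume h: "hit_time D w = enat m"
  let ?S = "enat ` {t. 1 \<le> t \<and> w t \<in> D}"
  have "?S \<noteq> {}"
  proof
    assume "?S = {}"
    then show False using h by (simp add: hit_time_def Inf_enat_def)
  qed
  then have "Inf ?S \<in> ?S" unfolding Inf_enat_def by (auto intro: LeastI)
  then have m: "1 \<le> m" "w m \<in> D" using h by (auto simp: hit_time_def)
  have "w i \<notin> D" if "1 \<le> i" "i < m" for i
  proof
    assume "w i \<in> D"
    then have "hit_time D w \<le> enat i" unfolding hit_time_def using that by (intro Inf_lower) auto
    then show False using h that by simp
  qed
  then show "1 \<le> m \<and> w m \<in> D \<and> (\<forall>i. 1 \<le> i \<and> i < m \<longrightarrow> w i \<notin> D)" using m by blast
next
  assume m: "1 \<le> m \<and> w m \<in> D \<and> (\<forall>i. 1 \<le> i \<and> i < m \<longrightarrow> w i \<notin> D)"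
  show "hit_time D w = enat m"
    unfolding hit_time_def
  proof (rule antisym)
    show "Inf (enat ` {t. 1 \<le> t \<and> w t \<in> D}) \<le> enat m" using m by (intro Inf_lower) auto
    show "enat m \<le> Inf (enat ` {t. 1 \<le> t \<and> w t \<in> D})"
      using m by (intro Inf_greatest) (auto simp: not_less[symmetric])
  qed
qed

lemma less_hit_time_iff: "enat m < hit_time D w \<longleftrightarrow> (\<forall>i. 1 \<le> i \<and> i \<le> m \<longrightarrow> w i \<notin> D)"
proof
  assume m: "enat m < hit_time D w"
  show "\<forall>i. 1 \<le> i \<and> i \<le> m \<longrightarrow> w i \<notin> D"
  proof (intro allI impI notI)
    fix i assume i: "1 \<le> i \<and> i \<le> m" "w i \<in> D"
    then have "hit_time D w \<le> enat i" unfolding hit_time_def by (intro Inf_lower) auto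
    then have "enat m < enat i" using m by (rule less_le_trans[rotated])
    then show False using i by simp
  qed
next
  assume "\<forall>i. 1 \<le> i \<and> i \<le> m \<longrightarrow> w i \<notin> D"
  then have "enat (Suc m) \<le> hit_time D w"
    unfolding hit_time_def by (intro Inf_greatest) (auto simp: not_less_eq_eq[symmetric])
  then show "enat m < hit_time D w" by (simp add: Suc_ile_eq)
qed

lemma countable_completed_space: "countable E \<Longrightarrow> countable (completed_space E)"
  by (simp add: completed_space_def)

section \<open>Transition and hitting probabilities of the killed chain\<close>

locale killed_chain = countable_chain "completed_space E" "completed_kernel E p" P X
  for E :: "'a set" and p :: "'a \<Rightarrow> 'a \<Rightarrow> real" and P :: "'a option \<Rightarrow> 'w measure" and X +
  assumes kernel_nonneg: "x \<in> E \<Longrightarrow> y \<in> E \<Longrightarrow> 0 \<le> p x y"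
begin

lemma Some_in: "x \<in> E \<Longrightarrow> Some x \<in> completed_space E"
  by (simp add: completed_space_def)

lemma countable_E: "countable E"
proof -
  have "countable (Some ` E)"
    using countable_S by (rule countable_subset[rotated]) (auto simp: completed_space_def)
  then show ?thesis by (rule countable_image_inj_on) simp
qed

lemma bij_Some: "bij_betw Some E (Some ` E)"
  by (simp add: bij_betw_def)

text \<open>The case of \<open>taboo_prob_embedded\<close> without taboo; the cemetery drops out of
  the sums because it is absorbing.\<close>

lemma emeasure_X_eq_step_kernel:
  assumes x: "x \<in> E" and z: "z \<in> E"
  shows "emeasure (P (Some x)) {\<omega> \<in> space (P (Some x)). X n \<omega> = Some z} = step_kernel E p n x z"
proof -
  have "taboo_prob P X UNIV (Some x) n (Some z) * ennreal 1 = step_kernel E p n x z * ennreal 1"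
    by (rule taboo_prob_embedded[where k="\<lambda>_. 1"])
       (auto simp: completed_space_def kernel_nonneg x z)
  then show ?thesis by (simp add: taboo_prob_def)
qed

text \<open>Optional stopping at the first visit to \<open>y\<close> after time 0. The mean
  \<open>\<Phi> n\<close> of \<open>f\<close> over paths that have not visited \<open>y\<close>
  before time \<open>n\<close> starts at \<open>f x\<close> and loses exactly \<open>f y\<close>
  times the first passage probability at each step, so the total loss is at most
  \<open>f x\<close>.\<close>

lemma hitting_prob_harmonic:
  assumes f: "\<And>z. 0 \<le> f z" and harm: "\<And>z. z \<in> E \<Longrightarrow> trans_op E p (\<lambda>y. ennreal (f y)) z = ennreal (f z)"
    and x: "x \<in> E" and y: "y \<in> E"
  shows "hitting_prob P X x y * f y \<le> f x"
proof -
  interpret prob_space "P (Some x)" by (rule prob_space_P[OF Some_in[OF x]])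
  \<comment> \<open>\<open>t n\<close> describes paths avoiding \<open>y\<close> strictly between 0
    and \<open>n\<close>, \<open>c n\<close> removes those at \<open>y\<close> at time
    \<open>n\<close>, and \<open>d n\<close> is the first passage probability. Time 0 is exempt,
    since hitting is counted from time 1.\<close>
  define t where "t n z = taboo_prob P X (- {Some y}) (Some x) n (Some z)" for n z
  define c where "c n w = (if n = 0 \<or> w \<noteq> y then t n w else 0)" for n w
  define \<Phi> where "\<Phi> n = (\<integral>\<^sup>+z. t n z * ennreal (f z) \<partial>count_space E)" for n
  define d where "d n = (if n = 0 then 0 else t n y)" for n
  have t_Suc: "t (Suc n) z = (\<integral>\<^sup>+w. c n w * ennreal (p w z) \<partial>count_space E)" if z: "z \<in> E" for n z
  proof -
    let ?g = "\<lambda>w. if n = 0 \<or> w \<in> - {Some y}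
      then taboo_prob P X (- {Some y}) (Some x) n w * ennreal (completed_kernel E p w (Some z)) else 0"
    have "t (Suc n) z = (\<integral>\<^sup>+w. ?g w \<partial>count_space (completed_space E))"
      unfolding t_def by (rule taboo_prob_Suc[OF Some_in[OF x] Some_in[OF z]])
    also have "\<dots> = (\<integral>\<^sup>+w. ?g w \<partial>count_space (Some ` E))"
      by (rule nn_integral_count_space_eq) (auto simp: completed_space_def)
    also have "\<dots> = (\<integral>\<^sup>+w. ?g (Some w) \<partial>count_space E)"
      by (rule nn_integral_bij_count_space[OF bij_Some, symmetric])
    also have "\<dots> = (\<integral>\<^sup>+w. c n w * ennreal (p w z) \<partial>count_space E)"
      by (intro nn_integral_cong) (auto simp: c_def t_def)
    finally show ?thesis .
  qed
  \<comment> \<open>By harmonicity one step preserves the mean of \<open>f\<close> over the paths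
    retained by \<open>c n\<close>.\<close>
  have \<Phi>_Suc: "\<Phi> (Suc n) = (\<integral>\<^sup>+w. c n w * ennreal (f w) \<partial>count_space E)" for n
  proof -
    have "\<Phi> (Suc n) = (\<integral>\<^sup>+z. \<integral>\<^sup>+w. c n w * (ennreal (p w z) * ennreal (f z)) \<partial>count_space E \<partial>count_space E)"
      unfolding \<Phi>_def by (intro nn_integral_cong) (simp add: t_Suc nn_integral_multc[symmetric] mult.assoc)
    also have "\<dots> = (\<integral>\<^sup>+w. \<integral>\<^sup>+z. c n w * (ennreal (p w z) * ennreal (f z)) \<partial>count_space E \<partial>count_space E)"
      by (rule nn_integral_count_space_nn_integral[OF countable_E]) simp
    also have "\<dots> = (\<integral>\<^sup>+w. c n w * ennreal (f w) \<partial>count_space E)"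
      by (intro nn_integral_cong) (simp add: nn_integral_cmult harm[unfolded trans_op_def])
    finally show ?thesis .
  qed
  have single: "(\<integral>\<^sup>+z. g z * indicator {a} z \<partial>count_space E) = g a" if "a \<in> E" for g :: "'a \<Rightarrow> ennreal" and a
    using that by (subst nn_integral_count_space'[of "{a}"]) auto
  have \<Phi>_step: "\<Phi> n = \<Phi> (Suc n) + d n * ennreal (f y)" for n
  proof -
    have "\<Phi> n = (\<integral>\<^sup>+w. c n w * ennreal (f w) + d n * ennreal (f w) * indicator {y} w \<partial>count_space E)"
      unfolding \<Phi>_def by (intro nn_integral_cong) (auto simp: c_def d_def split: split_indicator)
    also have "\<dots> = \<Phi> (Suc n) + d n * ennreal (f y)"
      by (simp add: nn_integral_add \<Phi>_Suc single[OF y])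
    finally show ?thesis .
  qed
  have \<Phi>_0: "\<Phi> 0 = ennreal (f x)"
  proof -
    have "\<Phi> 0 = (\<integral>\<^sup>+z. ennreal (f z) * indicator {x} z \<partial>count_space E)"
      unfolding \<Phi>_def t_def using taboo_prob_0[OF Some_in[OF x]]
      by (intro nn_integral_cong) (auto split: split_indicator)
    then show ?thesis by (simp add: single[OF x])
  qed
  have "(\<Sum>j<n. d j * ennreal (f y)) + \<Phi> n = ennreal (f x)" for n
  proof (induction n)
    case (Suc n)
    then show ?case using \<Phi>_step[of n] by (simp add: ac_simps)
  qed (simp add: \<Phi>_0)
  then have partial: "(\<Sum>j<n. d j * ennreal (f y)) \<le> ennreal (f x)" for n
    by (metis le_iff_add)
  \<comment> \<open>\<open>ev j\<close> is the event of a first visit at time \<open>j\<close>.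
    These events cover the hitting event, so subadditivity bounds its probability by the sum of the
    \<open>d j\<close>.\<close>
  define ev where "ev j = (if j = 0 then {} else {\<omega> \<in> space (P (Some x)).
      (\<forall>i. 0 < i \<and> i < j \<longrightarrow> X i \<omega> \<in> - {Some y}) \<and> X j \<omega> = Some y})" for j
  note [measurable] = pred_X_eq[OF Some_in[OF x]] pred_X[OF Some_in[OF x]]
  have ev_sets: "ev j \<in> sets (P (Some x))" for j
    unfolding ev_def by simp
  have "{\<omega> \<in> space (P (Some x)). \<exists>t>0. X t \<omega> = Some y} \<subseteq> (\<Union>j. ev j)"
  proof
    fix \<omega> assume "\<omega> \<in> {\<omega> \<in> space (P (Some x)). \<exists>t>0. X t \<omega> = Some y}"
    then obtain t where \<omega>: "\<omega> \<in> space (P (Some x))" and t: "0 < t \<and> X t \<omega> = Some y" by auto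
    have "\<omega> \<in> ev (LEAST t. 0 < t \<and> X t \<omega> = Some y)"
      using \<omega> LeastI[of "\<lambda>t. 0 < t \<and> X t \<omega> = Some y", OF t]
      by (auto simp: ev_def dest: not_less_Least)
    then show "\<omega> \<in> (\<Union>j. ev j)" by blast
  qed
  then have "emeasure (P (Some x)) {\<omega> \<in> space (P (Some x)). \<exists>t>0. X t \<omega> = Some y} \<le>
      emeasure (P (Some x)) (\<Union>j. ev j)"
    using ev_sets by (intro emeasure_mono) auto
  also have "\<dots> \<le> (\<Sum>j. emeasure (P (Some x)) (ev j))"
    using ev_sets by (intro emeasure_subadditive_countably) auto
  also have "\<dots> = (\<Sum>j. d j)"
    by (intro suminf_cong) (auto simp: ev_def d_def t_def taboo_prob_def)
  finally have Q: "ennreal (hitting_prob P X x y) \<le> (\<Sum>j. d j)"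
    by (simp add: hitting_prob_def emeasure_eq_measure)
  have "ennreal (hitting_prob P X x y * f y) = ennreal (hitting_prob P X x y) * ennreal (f y)"
    by (rule ennreal_mult) (simp_all add: hitting_prob_def f)
  also have "\<dots> \<le> (\<Sum>j. d j) * ennreal (f y)"
    using Q by (rule mult_right_mono) simp
  also have "\<dots> = (\<Sum>j. d j * ennreal (f y))" by simp
  also have "\<dots> \<le> ennreal (f x)"
    unfolding suminf_eq_SUP by (rule SUP_least) (rule partial)
  finally show ?thesis using f by simp
qed

end

section \<open>The exit from the translate of \<open>E\<close>\<close>

context shift_kernel
begin

text \<open>For \<open>w = z \<otimes> u\<close> the two terms of the kernel cancel. The remainder
  has nonnegative terms and is the mean of \<open>h\<close> over one jump from
  \<open>x \<otimes> u\<close> into \<open>E\<close> but out of \<open>E #> u\<close>.\<close>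

lemma A_op_eq:
  assumes x: "x \<in> E" and h: "\<And>y. y \<in> E \<Longrightarrow> 0 \<le> h y"
  shows "A_op \<G> E p u h x =
    enn2ereal (\<integral>\<^sup>+w. ennreal (p (x \<otimes> u) w * h w) \<partial>count_space (E - (E #> u)))"
proof -
  interpret group \<G> by (rule group_G)
  let ?g = "\<lambda>w. if w \<in> E #> u then 0 else ennreal (p (x \<otimes> u) w * h w)"
  have "A_op \<G> E p u h x = (\<Sum>\<^sub>\<infinity>w\<in>E. enn2ereal (?g w))"
    unfolding A_op_def
  proof (rule infsum_cong)
    fix w assume w: "w \<in> E"
    show "ereal (a_kernel \<G> E p u x w * h w) = enn2ereal (?g w)"
    proof (cases "w \<in> E #> u")
      case True
      then obtain z where z: "z \<in> E" "w = z \<otimes> u" by (auto simp: coset_eq)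
      then have "w \<otimes> inv u = z" using E_carrier u_in by (auto simp: m_assoc subset_iff)
      then show ?thesis using True p_shift[OF x z(1)] z(2) by (simp add: a_kernel_def zero_ennreal.rep_eq)
    next
      case False
      then show ?thesis
        using p_nonneg[OF shift_in[OF x] w] h[OF w] by (simp add: a_kernel_def)
    qed
  qed
  also have "\<dots> = enn2ereal (\<integral>\<^sup>+w. ?g w \<partial>count_space E)"
    by (rule infsum_ereal_eq_nn_integral[OF countable_E])
  also have "(\<integral>\<^sup>+w. ?g w \<partial>count_space E) = (\<integral>\<^sup>+w. ?g w \<partial>count_space (E - (E #> u)))"
    by (rule nn_integral_count_space_eq) auto
  also have "\<dots> = (\<integral>\<^sup>+w. ennreal (p (x \<otimes> u) w * h w) \<partial>count_space (E - (E #> u)))"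
    by (intro nn_integral_cong) auto
  finally show ?thesis .
qed

text \<open>
  Up to its exit time the chain started at \<open>y \<star> u\<close> moves inside \<open>E \<star> u\<close> like a translate of the
  chain started at \<open>y\<close>, so that its position just before the exit is governed by \<open>G(y, \<cdot>)\<close>.
\<close>

lemma green_op_A_op:
  fixes P :: "'a option \<Rightarrow> 'w measure"
  assumes mc: "markov_chain (completed_space E) (completed_kernel E p) P X"
    and h: "\<And>y. y \<in> E \<Longrightarrow> 0 \<le> h y" and y: "y \<in> E"
  shows "green_op E P X (A_op \<G> E p u h) y = enn2ereal (exit_expectation \<G> E u P X h (y \<otimes> u))"
proof -
  interpret killed_chain E p P X
    by unfold_locales (simp_all add: countable_completed_space countable_E p_nonneg mc)
  define W where "W = E - (E #> u)"
  define B where "B = Some ` (E #> u)"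
  define M where "M = P (Some (y \<otimes> u))"
  \<comment> \<open>For \<open>w\<close> in \<open>W\<close>, \<open>ev (n, w)\<close> means exit at
    time \<open>n + 1\<close> into \<open>w\<close>, so \<open>n\<close> is the last time before the
    exit. As \<open>W\<close> lies in \<open>E\<close>, a path that exits by being killed is in none
    of these events.\<close>
  define ev where "ev c = {\<omega> \<in> space M. (\<forall>i. 0 < i \<and> i < Suc (fst c) \<longrightarrow> X i \<omega> \<in> B) \<and>
      X (Suc (fst c)) \<omega> = Some (snd c)}" for c :: "nat \<times> 'a"
  have W: "countable W" "W \<subseteq> E" using countable_E by (auto simp: W_def)
  have yu: "Some (y \<otimes> u) \<in> completed_space E" using shift_in[OF y] by (rule Some_in)
  note [measurable] = pred_X_eq[OF yu, folded M_def] pred_X[OF yu, folded M_def]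
  have ev_sets: "ev c \<in> sets M" for c unfolding ev_def by measurable
  have B: "B = (\<lambda>z. Some (z \<otimes> u)) ` E" by (auto simp: B_def coset_eq)
  have inj: "inj_on (\<lambda>z. Some (z \<otimes> u)) E" using inj_shift by (simp add: inj_on_def)
  have B_sub: "B \<subseteq> completed_space E" using shift_in by (auto simp: B Some_in)

  \<comment> \<open>Up to the exit the chain is a translate of the chain on \<open>E\<close>, by the
    invariance of \<open>p\<close>.\<close>
  have taboo: "taboo_prob P X B (Some (y \<otimes> u)) n (Some (z \<otimes> u)) = step_kernel E p n y z"
    if z: "z \<in> E" for n z
  proof -
    have "taboo_prob P X B (Some (y \<otimes> u)) n (Some (z \<otimes> u)) * ennreal 1 = step_kernel E p n y z * ennreal 1"
      by (rule taboo_prob_embedded[where k="\<lambda>_. 1" and \<phi>="\<lambda>z. Some (z \<otimes> u)"])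
         (use inj B_sub in \<open>auto simp: B p_nonneg p_shift y z\<close>)
    then show ?thesis by simp
  qed
  have exit: "emeasure M (ev (n, w)) =
      (\<integral>\<^sup>+x. step_kernel E p n y x * ennreal (p (x \<otimes> u) w) \<partial>count_space E)" if w: "w \<in> E" for n w
  proof -
    have "emeasure M (ev (n, w)) = taboo_prob P X B (Some (y \<otimes> u)) (Suc n) (Some w)"
      by (simp add: ev_def taboo_prob_def M_def)
    also have "\<dots> = (\<integral>\<^sup>+v. taboo_prob P X B (Some (y \<otimes> u)) n v *
        ennreal (completed_kernel E p v (Some w)) \<partial>count_space B)"
      using B_sub y by (intro taboo_prob_Suc_on yu Some_in w) (auto simp: B)
    also have "\<dots> = (\<integral>\<^sup>+x. taboo_prob P X B (Some (y \<otimes> u)) n (Some (x \<otimes> u)) *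
        ennreal (completed_kernel E p (Some (x \<otimes> u)) (Some w)) \<partial>count_space E)"
      using inj by (intro nn_integral_bij_count_space[symmetric]) (simp add: bij_betw_def B)
    also have "\<dots> = (\<integral>\<^sup>+x. step_kernel E p n y x * ennreal (p (x \<otimes> u) w) \<partial>count_space E)"
      by (intro nn_integral_cong) (simp add: taboo)
    finally show ?thesis .
  qed

  \<comment> \<open>The exit time is unique, so at most one pair \<open>c\<close> contributes; none
    does when the path never exits or exits by being killed.\<close>
  have pointwise: "ennreal (h (the (X (the_enat (\<eta>_exit \<G> E u X \<omega>)) \<omega>))) *
        indicator {\<omega>. \<eta>_exit \<G> E u X \<omega> < \<tau>_cemetery X \<omega>} \<omega> =
      (\<integral>\<^sup>+c. ennreal (h (snd c)) * indicator (ev c) \<omega> \<partial>count_space (UNIV \<times> W))"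
    if \<omega>: "\<omega> \<in> space M" for \<omega>
  proof (cases "\<exists>c\<in>UNIV \<times> W. \<omega> \<in> ev c")
    case True
    then obtain n w where w: "w \<in> W" and ev: "\<omega> \<in> ev (n, w)" by auto
    have stay: "X i \<omega> \<in> B" if "1 \<le> i" "i < Suc n" for i using ev that by (auto simp: ev_def)
    have out: "X (Suc n) \<omega> = Some w" using ev by (simp add: ev_def)
    have nB: "Some w \<notin> B" using w by (auto simp: W_def B_def)
    have \<eta>: "\<eta>_exit \<G> E u X \<omega> = enat (Suc n)"
      unfolding \<eta>_exit_def hit_time_eq_enat_iff B_def[symmetric] using stay out nB by auto
    have "X i \<omega> \<noteq> None" if "1 \<le> i" "i \<le> Suc n" for i
      using stay[of i] out that by (cases "i = Suc n") (auto simp: B_def)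
    then have \<tau>: "\<eta>_exit \<G> E u X \<omega> < \<tau>_cemetery X \<omega>"
      unfolding \<eta> \<tau>_cemetery_def less_hit_time_iff by auto
    have uniq: "c = (n, w)" if c: "c \<in> UNIV \<times> W" "\<omega> \<in> ev c" for c
    proof -
      have c': "\<forall>i. 0 < i \<and> i < Suc (fst c) \<longrightarrow> X i \<omega> \<in> B" "X (Suc (fst c)) \<omega> = Some (snd c)"
        using c(2) by (auto simp: ev_def)
      have "Some (snd c) \<notin> B" using c(1) by (auto simp: W_def B_def)
      then have "\<not> fst c < n" "\<not> n < fst c"
        using stay[of "Suc (fst c)"] c' out nB by auto
      then have "fst c = n" by simp
      then show ?thesis using c'(2) out by (auto simp: prod_eq_iff)
    qed
    have "(\<integral>\<^sup>+c. ennreal (h (snd c)) * indicator (ev c) \<omega> \<partial>count_space (UNIV \<times> W)) =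
        (\<Sum>c\<in>{(n, w)}. ennreal (h (snd c)) * indicator (ev c) \<omega>)"
      using w uniq by (intro nn_integral_count_space') (auto simp: indicator_def)
    then show ?thesis using ev out \<tau> by (simp add: \<eta>)
  next
    case False
    have "\<not> \<eta>_exit \<G> E u X \<omega> < \<tau>_cemetery X \<omega>"
    proof
      assume less: "\<eta>_exit \<G> E u X \<omega> < \<tau>_cemetery X \<omega>"
      then obtain m where m: "\<eta>_exit \<G> E u X \<omega> = enat m" by (cases "\<eta>_exit \<G> E u X \<omega>") auto
      then have "1 \<le> m" "X m \<omega> \<notin> B" "\<And>i. 1 \<le> i \<Longrightarrow> i < m \<Longrightarrow> X i \<omega> \<in> B"
        unfolding \<eta>_exit_def hit_time_eq_enat_iff B_def[symmetric] by auto
      note m' = this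
      have "X m \<omega> \<noteq> None"
        using less m'(1) unfolding m \<tau>_cemetery_def less_hit_time_iff by auto
      then obtain w where w: "X m \<omega> = Some w" "w \<in> E"
        using X_in_S[OF yu, of \<omega> m] \<omega> by (auto simp: M_def completed_space_def)
      then have "w \<in> W" using m'(2) by (auto simp: W_def B_def)
      moreover have "\<omega> \<in> ev (m - 1, w)" using w m' \<omega> by (auto simp: ev_def)
      ultimately show False using False by auto
    qed
    moreover have "(\<integral>\<^sup>+c. ennreal (h (snd c)) * indicator (ev c) \<omega> \<partial>count_space (UNIV \<times> W)) =
        (\<integral>\<^sup>+c. 0 \<partial>count_space ((UNIV :: nat set) \<times> W))"
      using False by (intro nn_integral_cong) (auto simp: indicator_def)
    ultimately show ?thesis by simp
  qed

  \<comment> \<open>\<open>A\<close> is \<open>A_op\<close> applied to \<open>h\<close> and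
    \<open>g\<close> the Green function from \<open>y\<close>, both in \<open>ennreal\<close>, where
    sums and integrals may be interchanged freely.\<close>
  define A where "A x = (\<integral>\<^sup>+w. ennreal (p (x \<otimes> u) w * h w) \<partial>count_space W)" for x
  define g where "g x = (\<Sum>t. step_kernel E p t y x)" for x
  have A_alt: "A x = (\<integral>\<^sup>+w. ennreal (p (x \<otimes> u) w) * ennreal (h w) \<partial>count_space W)" if "x \<in> E" for x
    unfolding A_def using W(2) h p_nonneg[OF shift_in[OF that]]
    by (intro nn_integral_cong ennreal_mult) auto
  have "exit_expectation \<G> E u P X h (y \<otimes> u) =
      (\<integral>\<^sup>+\<omega>. \<integral>\<^sup>+c. ennreal (h (snd c)) * indicator (ev c) \<omega> \<partial>count_space (UNIV \<times> W) \<partial>M)"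
    unfolding exit_expectation_def M_def[symmetric] by (intro nn_integral_cong pointwise)
  also have "\<dots> = (\<integral>\<^sup>+c. \<integral>\<^sup>+\<omega>. ennreal (h (snd c)) * indicator (ev c) \<omega> \<partial>M \<partial>count_space (UNIV \<times> W))"
    using W(1) ev_sets by (intro nn_integral_count_space_nn_integral) auto
  also have "\<dots> = (\<integral>\<^sup>+c. ennreal (h (snd c)) * emeasure M (ev c) \<partial>count_space (UNIV \<times> W))"
    using ev_sets by (simp add: nn_integral_cmult_indicator)
  also have "\<dots> = (\<integral>\<^sup>+n. \<integral>\<^sup>+w. ennreal (h w) * emeasure M (ev (n, w)) \<partial>count_space W \<partial>count_space UNIV)"
    using W(1) by (subst nn_integral_count_space_Times) auto
  also have "\<dots> = (\<integral>\<^sup>+n. \<integral>\<^sup>+x. step_kernel E p n y x * A x \<partial>count_space E \<partial>count_space UNIV)"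
  proof (rule nn_integral_cong)
    fix n :: nat
    have "(\<integral>\<^sup>+w. ennreal (h w) * emeasure M (ev (n, w)) \<partial>count_space W) =
      (\<integral>\<^sup>+w. \<integral>\<^sup>+x. step_kernel E p n y x * (ennreal (p (x \<otimes> u) w) * ennreal (h w)) \<partial>count_space E \<partial>count_space W)"
      using W(2)
      by (intro nn_integral_cong) (auto simp: exit nn_integral_cmult[symmetric] ac_simps)
    also have "\<dots> = (\<integral>\<^sup>+x. \<integral>\<^sup>+w. step_kernel E p n y x * (ennreal (p (x \<otimes> u) w) * ennreal (h w)) \<partial>count_space W \<partial>count_space E)"
      by (rule nn_integral_count_space_nn_integral[OF countable_E]) simp
    also have "\<dots> = (\<integral>\<^sup>+x. step_kernel E p n y x * A x \<partial>count_space E)"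
      by (intro nn_integral_cong) (simp add: nn_integral_cmult A_alt)
    finally show "(\<integral>\<^sup>+w. ennreal (h w) * emeasure M (ev (n, w)) \<partial>count_space W) =
      (\<integral>\<^sup>+x. step_kernel E p n y x * A x \<partial>count_space E)" .
  qed
  also have "\<dots> = (\<integral>\<^sup>+x. \<integral>\<^sup>+n. step_kernel E p n y x * A x \<partial>count_space UNIV \<partial>count_space E)"
    by (rule nn_integral_count_space_nn_integral[OF countable_E]) simp
  also have "\<dots> = (\<integral>\<^sup>+x. g x * A x \<partial>count_space E)"
    by (simp add: nn_integral_count_space_nat g_def)
  finally have rhs: "exit_expectation \<G> E u P X h (y \<otimes> u) = (\<integral>\<^sup>+x. g x * A x \<partial>count_space E)" .

  have green: "green P X y x = enn2ereal (g x)" if x: "x \<in> E" for x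
  proof -
    interpret prob_space "P (Some y)" by (rule prob_space_P[OF Some_in[OF y]])
    have "ereal (\<P>(\<omega> in P (Some y). X t \<omega> = Some x)) = enn2ereal (step_kernel E p t y x)" for t
      using emeasure_X_eq_step_kernel[OF y x, of t] by (simp add: emeasure_eq_measure flip: enn2ereal_ennreal)
    then show ?thesis by (simp add: green_def g_def)
  qed
  have "green_op E P X (A_op \<G> E p u h) y = (\<Sum>\<^sub>\<infinity>x\<in>E. enn2ereal (g x * A x))"
    unfolding green_op_def
    by (intro infsum_cong) (simp add: green A_op_eq[OF _ h] A_def W_def times_ennreal.rep_eq)
  also have "\<dots> = enn2ereal (\<integral>\<^sup>+x. g x * A x \<partial>count_space E)"
    by (rule infsum_ereal_eq_nn_integral[OF countable_E])
  finally show ?thesis by (simp add: rhs)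
qed

section \<open>Staying probabilities of the h-transform and bounds from slow variation\<close>

lemma restrict_in_harmonic_cone:
  assumes "harmonic E p h"
  shows "(\<lambda>x. if x \<in> E then h x else 0) \<in> harmonic_cone"
proof -
  have h: "\<And>x. x \<in> E \<Longrightarrow> 0 \<le> h x" and sum: "\<And>x. x \<in> E \<Longrightarrow> ((\<lambda>y. p x y * h y) has_sum h x) E"
    using assms by (auto simp: harmonic_def)
  have "trans_op E p (\<lambda>y. ennreal (if y \<in> E then h y else 0)) x = ennreal (h x)" if x: "x \<in> E" for x
  proof -
    have "trans_op E p (\<lambda>y. ennreal (if y \<in> E then h y else 0)) x = (\<integral>\<^sup>+y. ennreal (p x y * h y) \<partial>count_space E)"
      unfolding trans_op_def using h p_nonneg[OF x] by (intro nn_integral_cong) (simp add: ennreal_mult)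
    also have "\<dots> = ennreal (h x)"
      using h p_nonneg[OF x] sum[OF x] by (intro has_sum_imp_nn_integral countable_E) auto
    finally show ?thesis .
  qed
  then show ?thesis using h by (auto simp: harmonic_cone_def)
qed

text \<open>The factors of \<open>h_transform\<close> telescope, so \<open>h (x \<otimes> u)\<close>
  times the probability of staying in \<open>E #> u\<close> up to time \<open>n\<close> is the
  \<open>n\<close>-th term of the sequence defining \<open>shift_minorant\<close> at
  \<open>x\<close>. By \<open>fixed\<close> its limit is \<open>h x\<close>.\<close>

lemma h_transform_stay_prob:
  fixes Ph :: "'a \<Rightarrow> 'v measure"
  assumes harm: "harmonic E p h" and pos: "\<And>z. z \<in> E \<Longrightarrow> 0 < h z"
    and fixed: "\<And>f. f \<in> harmonic_cone \<Longrightarrow> shift_minorant f = f"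
    and mc: "markov_chain E (h_transform p h) Ph Xh" and x: "x \<in> E"
  shows "h x / h (x \<otimes> u) = \<P>(\<omega> in Ph (x \<otimes> u). \<forall>t. Xh t \<omega> \<in> E #> u)"
proof -
  interpret countable_chain E "h_transform p h" Ph Xh
    by unfold_locales (auto simp: countable_E mc)
  define C where "C = E #> u"
  define M where M_def: "M = Ph (x \<otimes> u)"
  define f where "f z = (if z \<in> E then h z else 0)" for z
  have f: "f \<in> harmonic_cone" unfolding f_def[abs_def] by (rule restrict_in_harmonic_cone[OF harm])
  have xu: "x \<otimes> u \<in> E" by (rule shift_in[OF x])
  have zero: "AE \<omega> in M. Xh 0 \<omega> = x \<otimes> u" unfolding M_def by (rule AE_X_0[OF xu])
  interpret prob_space M unfolding M_def by (rule prob_space_P[OF xu])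
  note [measurable] = pred_X_eq[OF xu, folded M_def] pred_X[OF xu, folded M_def]
  define A where "A n = {\<omega> \<in> space M. \<forall>i\<le>n. Xh i \<omega> \<in> C}" for n
  have A_sets: "A n \<in> sets M" for n unfolding A_def by measurable
  have C: "countable C" "C \<subseteq> E" "x \<otimes> u \<in> C"
    using coset_subset countable_E x by (auto simp: C_def coset_eq)
  have taboo: "taboo_prob Ph Xh C (x \<otimes> u) n (z \<otimes> u) * ennreal (h (x \<otimes> u)) =
      step_kernel E p n x z * ennreal (h (z \<otimes> u))" if z: "z \<in> E" for n z
    by (rule taboo_prob_embedded[where k="\<lambda>z. h (z \<otimes> u)" and \<phi>="\<lambda>z. z \<otimes> u"])
       (use inj_shift x z pos shift_in p_nonneg p_shift in \<open>auto simp: C_def coset_eq h_transform_def\<close>)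
  have stay: "emeasure M (A n) * ennreal (h (x \<otimes> u)) = (trans_op E p ^^ n) (shift (\<lambda>y. ennreal (f y))) x" for n
  proof -
    define ev where "ev z = {\<omega> \<in> space M. (\<forall>i. 0 < i \<and> i < n \<longrightarrow> Xh i \<omega> \<in> C) \<and> Xh n \<omega> = z}" for z
    have ev_sets: "ev z \<in> sets M" for z unfolding ev_def by measurable
    \<comment> \<open>\<open>A n\<close> constrains time 0 and the taboo event does not; they agree
      almost surely because the start \<open>x \<otimes> u\<close> lies in \<open>C\<close>.\<close>
    have "emeasure M (A n) = emeasure M (\<Union>z\<in>C. ev z)"
    proof (rule emeasure_eq_AE)
      show "AE \<omega> in M. \<omega> \<in> A n \<longleftrightarrow> \<omega> \<in> (\<Union>z\<in>C. ev z)"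
        using zero
      proof eventually_elim
        case (elim \<omega>)
        have "(\<forall>i\<le>n. Xh i \<omega> \<in> C) \<longleftrightarrow> (\<forall>i. 0 < i \<and> i < n \<longrightarrow> Xh i \<omega> \<in> C) \<and> Xh n \<omega> \<in> C"
          using elim C(3) by (metis le_less neq0_conv)
        then show ?case by (auto simp: A_def ev_def)
      qed
      show "A n \<in> sets M" by (rule A_sets)
      show "(\<Union>z\<in>C. ev z) \<in> sets M" using C(1) ev_sets by (intro sets.countable_UN') auto
    qed
    also have "\<dots> = (\<integral>\<^sup>+z. emeasure M (ev z) \<partial>count_space C)"
      using C(1) ev_sets by (intro emeasure_UN_countable) (auto simp: disjoint_family_on_def ev_def)
    also have "\<dots> = (\<integral>\<^sup>+z. emeasure M (ev (z \<otimes> u)) \<partial>count_space E)"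
      unfolding C_def by (rule nn_integral_bij_count_space[OF bij_shift, symmetric])
    finally have "emeasure M (A n) * ennreal (h (x \<otimes> u)) =
        (\<integral>\<^sup>+z. taboo_prob Ph Xh C (x \<otimes> u) n (z \<otimes> u) * ennreal (h (x \<otimes> u)) \<partial>count_space E)"
      by (simp add: nn_integral_multc ev_def taboo_prob_def M_def)
    also have "\<dots> = (\<integral>\<^sup>+z. step_kernel E p n x z * shift (\<lambda>y. ennreal (f y)) z \<partial>count_space E)"
      by (intro nn_integral_cong) (simp add: taboo shift_def f_def shift_in)
    also have "\<dots> = (trans_op E p ^^ n) (shift (\<lambda>y. ennreal (f y))) x"
      by (rule trans_op_funpow[OF countable_E x, symmetric])
    finally show ?thesis .
  qed
  have "(\<lambda>n. emeasure M (A n)) \<longlonglongrightarrow> emeasure M (\<Inter>n. A n)"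
    using A_sets by (intro Lim_emeasure_decseq) (auto simp: A_def decseq_def)
  then have "(\<lambda>n. ennreal (h (x \<otimes> u)) * emeasure M (A n)) \<longlonglongrightarrow> ennreal (h (x \<otimes> u)) * emeasure M (\<Inter>n. A n)"
    by (intro ennreal_tendsto_cmult) auto
  moreover have "(\<lambda>n. ennreal (h (x \<otimes> u)) * emeasure M (A n)) \<longlonglongrightarrow> ennreal (f x)"
    using tendsto_shift_minorant[OF f x] by (simp add: stay[symmetric] fixed[OF f] mult.commute)
  ultimately have "ennreal (h (x \<otimes> u)) * emeasure M (\<Inter>n. A n) = ennreal (h x)"
    using x by (auto simp: f_def dest: LIMSEQ_unique)
  also have "(\<Inter>n. A n) = {\<omega> \<in> space M. \<forall>t. Xh t \<omega> \<in> C}" by (auto simp: A_def)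
  finally have "ennreal (h (x \<otimes> u) * \<P>(\<omega> in M. \<forall>t. Xh t \<omega> \<in> C)) = ennreal (h x)"
    using pos[OF xu] by (simp add: emeasure_eq_measure ennreal_mult')
  then have "h (x \<otimes> u) * \<P>(\<omega> in M. \<forall>t. Xh t \<omega> \<in> C) = h x"
    using pos[OF xu] pos[OF x] by (subst (asm) ennreal_inj) auto
  then show ?thesis
    using pos[OF xu] by (simp add: M_def C_def field_simps)
qed

text \<open>\<open>hitting_prob_harmonic\<close> is used in both directions between \<open>x\<close>
  and \<open>x \<otimes> u [^] n\<close>. The hitting probabilities do not involve \<open>f\<close>,
  so one threshold serves the whole cone.\<close>

lemma slowly_varying_harmonic_bounds:
  fixes P :: "'a option \<Rightarrow> 'w measure"
  assumes mc: "markov_chain (completed_space E) (completed_kernel E p) P X"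
    and irr: "irreducible_chain E P X" and slow: "slowly_varying_along \<G> E P X u"
    and \<epsilon>: "0 < \<epsilon>"
  shows "\<exists>N. \<forall>n\<ge>N. \<forall>f\<in>harmonic_cone. \<forall>x\<in>E.
      exp (- \<epsilon> * real n) * f x \<le> f (x \<otimes> u [^] n) \<and> f (x \<otimes> u [^] n) \<le> exp (\<epsilon> * real n) * f x"
proof -
  interpret killed_chain E p P X
    by unfold_locales (simp_all add: countable_completed_space countable_E p_nonneg mc)
  let ?Q = "hitting_prob P X"
  \<comment> \<open>Positivity is what lets \<open>exp\<close> undo \<open>ln\<close>.\<close>
  have Q_pos: "0 < ?Q x y" if "x \<in> E" "y \<in> E" for x y
  proof -
    interpret prob_space "P (Some x)" by (rule prob_space_P[OF Some_in[OF that(1)]])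
    note [measurable] = pred_X_eq[OF Some_in[OF that(1)]]
    obtain n where n: "n \<ge> 1" "0 < \<P>(\<omega> in P (Some x). X n \<omega> = Some y)"
      using irr \<open>x \<in> E\<close> \<open>y \<in> E\<close> unfolding irreducible_chain_def by blast
    note n(2)
    also have "\<P>(\<omega> in P (Some x). X n \<omega> = Some y) \<le> ?Q x y"
      unfolding hitting_prob_def using n(1) by (intro finite_measure_mono) (auto intro!: exI[of _ n])
    finally show ?thesis .
  qed
  have Q_bound: "exp (- \<epsilon> * real n) * f y \<le> f x"
    if "x \<in> E" "y \<in> E" "f \<in> harmonic_cone" "n \<ge> 1" "dist (1 / real n * ln (?Q x y)) 0 < \<epsilon>" for n f x y
  proof -
    have "- \<epsilon> * real n < ln (?Q x y)"
      using that(4,5) by (auto simp: dist_real_def abs_less_iff field_simps)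
    then have "exp (- \<epsilon> * real n) \<le> ?Q x y"
      using Q_pos[OF that(1,2)] by (metis exp_ln exp_le_cancel_iff less_imp_le)
    then have "exp (- \<epsilon> * real n) * f y \<le> ?Q x y * f y"
      using harmonic_coneD(1)[OF that(3)] by (rule mult_right_mono)
    also have "\<dots> \<le> f x"
      using harmonic_coneD(1,3)[OF that(3)] that(1,2) by (intro hitting_prob_harmonic) auto
    finally show ?thesis .
  qed
  have lim: "uniform_limit E (\<lambda>n x. 1 / real n * ln (?Q x (x \<otimes> u [^] n))) (\<lambda>x. 0) sequentially"
    "uniform_limit E (\<lambda>n x. 1 / real n * ln (?Q (x \<otimes> u [^] n) x)) (\<lambda>x. 0) sequentially"
    using slow by (auto simp: slowly_varying_along_def)
  obtain N1 where N1: "\<And>n x. n \<ge> N1 \<Longrightarrow> x \<in> E \<Longrightarrow> dist (1 / real n * ln (?Q x (x \<otimes> u [^] n))) 0 < \<epsilon>"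
    using uniform_limitD[OF lim(1) \<epsilon>] by (auto simp: eventually_sequentially)
  obtain N2 where N2: "\<And>n x. n \<ge> N2 \<Longrightarrow> x \<in> E \<Longrightarrow> dist (1 / real n * ln (?Q (x \<otimes> u [^] n) x)) 0 < \<epsilon>"
    using uniform_limitD[OF lim(2) \<epsilon>] by (auto simp: eventually_sequentially)
  show ?thesis
  \<comment> \<open>The 1 in the maximum excludes \<open>n = 0\<close>, where
    \<open>1 / real n\<close> is 0 by convention and the limit says nothing about
    \<open>Q\<close>.\<close>
  proof (intro exI[of _ "max 1 (max N1 N2)"] allI impI ballI conjI)
    fix n f x assume n: "max 1 (max N1 N2) \<le> n" and f: "f \<in> harmonic_cone" and x: "x \<in> E"
    have xn: "x \<otimes> u [^] n \<in> E" by (rule shift_pow_in[OF x])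
    show "exp (- \<epsilon> * real n) * f x \<le> f (x \<otimes> u [^] n)"
      using n by (intro Q_bound[OF xn x f] N2 x) auto
    have "exp (- \<epsilon> * real n) * f (x \<otimes> u [^] n) \<le> f x"
      using n by (intro Q_bound[OF x xn f] N1 x) auto
    then have "exp (\<epsilon> * real n) * (exp (- \<epsilon> * real n) * f (x \<otimes> u [^] n)) \<le> exp (\<epsilon> * real n) * f x"
      by (intro mult_left_mono) auto
    then show "f (x \<otimes> u [^] n) \<le> exp (\<epsilon> * real n) * f x"
      by (simp add: mult.assoc[symmetric] exp_add[symmetric])
  qed
qed

text \<open>Irreducibility gives a positive probability of hitting, from \<open>x\<close>, a point
  where \<open>h\<close> is positive, and \<open>hitting_prob_harmonic\<close> transports positivity
  back to \<open>x\<close>.\<close>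

lemma harmonic_pos:
  fixes P :: "'a option \<Rightarrow> 'w measure"
  assumes mc: "markov_chain (completed_space E) (completed_kernel E p) P X"
    and irr: "irreducible_chain E P X" and harm: "harmonic E p h" and x: "x \<in> E"
  shows "0 < h x"
proof -
  interpret killed_chain E p P X
    by unfold_locales (simp_all add: countable_completed_space countable_E p_nonneg mc)
  interpret prob_space "P (Some x)" by (rule prob_space_P[OF Some_in[OF x]])
  note [measurable] = pred_X_eq[OF Some_in[OF x]]
  define f where "f z = (if z \<in> E then h z else 0)" for z
  have f: "f \<in> harmonic_cone" unfolding f_def[abs_def] by (rule restrict_in_harmonic_cone[OF harm])
  obtain y where y: "y \<in> E" "0 < h y"
    using harm unfolding harmonic_def by (metis order_le_less)
  obtain n where n: "n \<ge> 1" "0 < \<P>(\<omega> in P (Some x). X n \<omega> = Some y)"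
    using irr x y(1) unfolding irreducible_chain_def by blast
  note n(2)
  also have "\<P>(\<omega> in P (Some x). X n \<omega> = Some y) \<le> hitting_prob P X x y"
    unfolding hitting_prob_def using n(1) by (intro finite_measure_mono) (auto intro!: exI[of _ n])
  finally have "0 < hitting_prob P X x y * f y" using y by (simp add: f_def)
  also have "\<dots> \<le> f x"
    using harmonic_coneD(1,3)[OF f] x y(1) by (intro hitting_prob_harmonic) auto
  finally show ?thesis using x by (simp add: f_def)
qed

end

theorem proposition3p1:
  fixes \<G> :: "('a, 'm) monoid_scheme"
    and E :: "'a set"
    and p :: "'a \<Rightarrow> 'a \<Rightarrow> real"
    and P :: "'a option \<Rightarrow> 'w measure"
    and X :: "nat \<Rightarrow> 'w \<Rightarrow> 'a option"
    and u :: 'a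
  assumes "group \<G>"
    and "E \<subseteq> carrier \<G>"
    and "countable E"
    and "substochastic E p"
    and "markov_chain (completed_space E) (completed_kernel E p) P X"
    and "irreducible_chain E P X"
    and "transient_chain E P X"
    and "u \<in> E"
    and "E #>\<^bsub>\<G>\<^esub> u \<subseteq> E"
    and "\<forall>x\<in>E. \<forall>y\<in>E. p (x \<otimes>\<^bsub>\<G>\<^esub> u) (y \<otimes>\<^bsub>\<G>\<^esub> u) = p x y"
  shows "(\<forall>h :: 'a \<Rightarrow> real. (\<forall>x\<in>E. 0 \<le> h x) \<longrightarrow>
            (\<forall>y\<in>E. green_op E P X (A_op \<G> E p u h) y
                     = enn2ereal (exit_expectation \<G> E u P X h (y \<otimes>\<^bsub>\<G>\<^esub> u))))
       \<and> (slowly_varying_along \<G> E P X u \<longrightarrow>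
            (\<forall>x\<in>E. \<forall>h. harmonic E p h \<longrightarrow>
              (\<forall>(Ph :: 'a \<Rightarrow> 'v measure) (Xh :: nat \<Rightarrow> 'v \<Rightarrow> 'a).
                 markov_chain E (h_transform p h) Ph Xh \<longrightarrow>
                   h x / h (x \<otimes>\<^bsub>\<G>\<^esub> u)
                     = \<P>(\<omega> in Ph (x \<otimes>\<^bsub>\<G>\<^esub> u). \<forall>t. Xh t \<omega> \<in> E #>\<^bsub>\<G>\<^esub> u))))"
proof -
  interpret shift_kernel \<G> E p u
    using assms by (intro shift_kernel.intro) (auto simp: substochastic_def)
  note mc = assms(5) and irr = assms(6)
  show ?thesis
  proof (intro conjI allI impI ballI)
    fix h :: "'a \<Rightarrow> real" and y assume "\<forall>x\<in>E. 0 \<le> h x" "y \<in> E"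
    then show "green_op E P X (A_op \<G> E p u h) y =
        enn2ereal (exit_expectation \<G> E u P X h (y \<otimes>\<^bsub>\<G>\<^esub> u))"
      by (intro green_op_A_op[OF mc]) auto
  next
    fix x h and Ph :: "'a \<Rightarrow> 'v measure" and Xh :: "nat \<Rightarrow> 'v \<Rightarrow> 'a"
    assume slow: "slowly_varying_along \<G> E P X u" and "x \<in> E"
      and harm: "harmonic E p h" and "markov_chain E (h_transform p h) Ph Xh"
    have "shift_minorant f = f" if "f \<in> harmonic_cone" for f
      using slowly_varying_harmonic_bounds[OF mc irr slow] that by (rule shift_minorant_eq)
    then show "h x / h (x \<otimes>\<^bsub>\<G>\<^esub> u) = \<P>(\<omega> in Ph (x \<otimes>\<^bsub>\<G>\<^esub> u). \<forall>t. Xh t \<omega> \<in> E #>\<^bsub>\<G>\<^esub> u)"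
      using harmonic_pos[OF mc irr harm] \<open>x \<in> E\<close> harm \<open>markov_chain E (h_transform p h) Ph Xh\<close>
      by (intro h_transform_stay_prob) auto
  qed
qed

end
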